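(* Let $X=X_{-\infty}^0$ be a stationary irreducible $m$-th order Markov chain with alphabet $\{0,1\}$ (some transition probabilities are allowed to be zero). For $0<\varepsilon<1$ let $Z_\varepsilon=\{Z_i(\varepsilon)\}$ be the output hidden Markov chain obtained by passing $X$ through $\mathrm{BSC}(\varepsilon)$. Then, as $\varepsilon\to 0^+$, $$H(Z_\varepsilon)=H(X)+f(X)\,\varepsilon\log(1/\varepsilon)+g(X)\,\varepsilon+O(\varepsilon^2\log\varepsilon),$$ where $f(X)=f_{2m}^0(X_{-2m}^0)=f_{2m}^m(X_{-2m}^0)$ and $g(X)=g_{3m}^0(X_{-3m}^0)=g_{3m}^m(X_{-3m}^0)$ (in particular these two pairs of expressions coincide).
   Context: All logarithms are natural, with $0\log 0=0$. $\mathcal X=\{0,1\}$, $\oplus$ is addition mod 2, $\bar a=1\oplus a$. Markov chains: $X$ is an $m$-th order Markov chain if the conditional law of $X_t$ given the whole past depends only on $X_{t-m}^{t-1}$. It is irreducible if the associated first-order chain on the $m$-blocks of positive stationary probability is irreducible. Entropy rate: for a stationary process $W=W_{-\infty}^0$ over a finite alphabet, $H(W)=\lim_{n\to\infty}\frac1{n+1}H(W_{-n}^0)$, where $H(W_{-n}^0)$ is the Shannon entropy of $W_{-n}^0=(W_{-n},\dots,W_0)$. Channel: $\mathrm{BSC}(\varepsilon)$ is the binary symmetric channel with crossover probability $\varepsilon$. Its output is $Z_i(\varepsilon)=X_i\oplus E_i$, where $E=\{E_i\}$ is i.i.d. with $P(E_i=1)=\varepsilon$, $P(E_i=0)=1-\varepsilon$,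 independent of $X$. Notation: for a binary word $u$, $p_X(u)$ is the probability that $X$ takes the value $u$ on a block of consecutive times of the same length (well defined by stationarity), and $p_X(v|w)=p_X(wv)/p_X(w)$. $\mathcal A(X)$ is the set of binary words $u$ with $p_X(u)>0$. The quantities $f_n^k,g_n^k$: let $0\le k\le n$. Below $w=w_{-n}^{-1}$ ranges over binary words of length $n$ and $v$ over $\{0,1\}$; $wv$ is the concatenation. For a binary word $u$ of length $\ell\ge k$, define $$h_\ell^k(u)=\sum_{u'}p_X(u')-(\ell-k)\,p_X(u),$$ where $u'$ runs over the $\ell-k$ words obtained from $u$ by flipping exactly one of its last $\ell-k$ letters. Thus $h_n^k(w)=\sum_{j=1}^{n-k}p_X(w_{-n}^{-j-1}\bar w_{-j}w_{-j+1}^{-1})-(n-k)p_X(w)$, and $h_{n+1}^k(wv)$ is defined by flipping one of the last $n+1-k$ letters of $wv$. Put $$p_{XZ}(w)=P(X_{-n}^{-n+k-1}=w_{-n}^{-n+k-1},\ Z_{-n+k}^{-1}(\varepsilon)=w_{-n+k}^{-1}),$$ $$p_{XZ}(wv)=P(X_{-n}^{-n+k-1}=w_{-n}^{-n+k-1},\ Z_{-n+k}^{-1}(\varepsilon)=w_{-n+k}^{-1},\ Z_0(\varepsilon)=v).$$ Then $$f_n^k(X_{-n}^0)=\sum_{w\in\mathcal A(X),\,wv\notin\mathcal A(X)}h_{n+1}^k(wv),$$ $$g_n^k(X_{-n}^0)=-\sum_{wv\in\mathcal A(X)}\Big(h_{n+1}^k(wv)\log p_X(v|w)+\frac{h_{n+1}^k(wv)p_X(w)-h_n^k(w)p_X(wv)}{p_X(w)}\Big)$$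 $$-\sum_{w\in\mathcal A(X),\,wv\notin\mathcal A(X)}h_{n+1}^k(wv)\log\frac{h_{n+1}^k(wv)}{p_X(w)}-\sum_{p_{XZ}(w)=\Theta(\varepsilon),\,p_{XZ}(wv)=\Theta(\varepsilon)}h_{n+1}^k(wv)\log\frac{h_{n+1}^k(wv)}{h_n^k(w)},$$ where $\Theta(\varepsilon)$ is meant as $\varepsilon\to0^+$: $\alpha=\Theta(\beta)$ means $C_1|\beta|\le|\alpha|\le C_2|\beta|$ for some positive constants $C_1,C_2$. The $O(\varepsilon^2\log\varepsilon)$ term is bounded in absolute value by $C\varepsilon^2|\log\varepsilon|$ for all sufficiently small $\varepsilon>0$, with $C$ not depending on $\varepsilon$. *)

theory Defs
  imports "HOL-Probability.Probability" "HOL-Library.Landau_Symbols"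
begin

text \<open>
  The alphabet {0,1} is \<open>bool\<close>, with \<open>True\<close> for 1: addition mod 2 is \<open>\<noteq>\<close> and the flip of a letter is
  \<open>\<not>\<close>. A process indexed by the times ..., -1, 0 is a function \<open>W :: int \<Rightarrow> 'a \<Rightarrow> bool\<close> on a probability
  space, of which only the values at times \<open>i \<le> 0\<close> are ever used. Binary words are lists, leftmost
  letter first, and \<open>w @ [v]\<close> is the concatenation \<open>wv\<close>.
\<close>

section \<open>Processes\<close>

text \<open>\<open>block W t n\<close> is the word of the \<open>n\<close> letters at times \<open>t\<close>, ..., \<open>t + n - 1\<close>.\<close>

definition block :: "(int \<Rightarrow> 'a \<Rightarrow> bool) \<Rightarrow> int \<Rightarrow> nat \<Rightarrow> 'a \<Rightarrow> bool list" where
  "block W t n \<omega> = map (\<lambda>j. W (t + int j) \<omega>) [0..<n]"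

abbreviation traj_space :: "int set \<Rightarrow> (int \<Rightarrow> bool) measure" where
  "traj_space I \<equiv> PiM I (\<lambda>_. count_space UNIV)"

definition trajectory :: "int set \<Rightarrow> (int \<Rightarrow> 'a \<Rightarrow> bool) \<Rightarrow> 'a \<Rightarrow> int \<Rightarrow> bool" where
  "trajectory I W \<omega> = (\<lambda>i\<in>I. W i \<omega>)"

definition binary_process :: "'a measure \<Rightarrow> (int \<Rightarrow> 'a \<Rightarrow> bool) \<Rightarrow> bool" where
  "binary_process M W \<longleftrightarrow> (\<forall>i\<le>0. W i \<in> M \<rightarrow>\<^sub>M count_space UNIV)"

definition stationary :: "'a measure \<Rightarrow> (int \<Rightarrow> 'a \<Rightarrow> bool) \<Rightarrow> bool" where
  "stationary M W \<longleftrightarrow>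
     (\<forall>s::nat. distr M (traj_space {..0}) (trajectory {..0} (\<lambda>i. W (i - int s))) =
               distr M (traj_space {..0}) (trajectory {..0} W))"

definition past :: "'a measure \<Rightarrow> (int \<Rightarrow> 'a \<Rightarrow> bool) \<Rightarrow> int \<Rightarrow> 'a measure" where
  "past M W t = vimage_algebra (space M) (trajectory {..<t} W) (traj_space {..<t})"

definition markov_of_order :: "'a measure \<Rightarrow> nat \<Rightarrow> (int \<Rightarrow> 'a \<Rightarrow> bool) \<Rightarrow> bool" where
  "markov_of_order M m X \<longleftrightarrow>
     (\<forall>t\<le>0. \<forall>a. \<exists>q :: bool list \<Rightarrow> real.
        AE \<omega> in M. real_cond_exp M (past M X t) (indicator {\<omega>\<in>space M. X t \<omega> = a}) \<omega>
                   = q (block X (t - int m) m \<omega>))"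

text \<open>The first-order chain on \<open>m\<close>-blocks; the block ending at time -1 is followed by the one ending at
  time 0.\<close>

definition block_states :: "'a measure \<Rightarrow> nat \<Rightarrow> (int \<Rightarrow> 'a \<Rightarrow> bool) \<Rightarrow> bool list set" where
  "block_states M m X = {u. length u = m \<and> \<P>(\<omega> in M. block X (- int m) m \<omega> = u) > 0}"

definition block_transition ::
  "'a measure \<Rightarrow> nat \<Rightarrow> (int \<Rightarrow> 'a \<Rightarrow> bool) \<Rightarrow> bool list \<Rightarrow> bool list \<Rightarrow> real" where
  "block_transition M m X u u' =
     \<P>(\<omega> in M. block X (1 - int m) m \<omega> = u' \<bar> block X (- int m) m \<omega> = u)"

definition irreducible_of_order :: "'a measure \<Rightarrow> nat \<Rightarrow> (int \<Rightarrow> 'a \<Rightarrow> bool) \<Rightarrow> bool" where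
  "irreducible_of_order M m X \<longleftrightarrow>
     (\<forall>u\<in>block_states M m X. \<forall>u'\<in>block_states M m X.
        (\<lambda>a b. a \<in> block_states M m X \<and> b \<in> block_states M m X \<and> block_transition M m X a b > 0)\<^sup>*\<^sup>* u u')"

section \<open>The binary symmetric channel\<close>

definition bsc_noise ::
  "'a measure \<Rightarrow> (int \<Rightarrow> 'a \<Rightarrow> bool) \<Rightarrow> real \<Rightarrow> (int \<Rightarrow> 'a \<Rightarrow> bool) \<Rightarrow> bool" where
  "bsc_noise M X \<epsilon> N \<longleftrightarrow>
     prob_space.indep_vars M (\<lambda>_. count_space UNIV) N {..0} \<and>
     (\<forall>i\<le>0. \<P>(\<omega> in M. N i \<omega>) = \<epsilon>) \<and>
     prob_space.indep_var M (traj_space {..0}) (trajectory {..0} X) (traj_space {..0}) (trajectory {..0} N)"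

definition bsc_output :: "(int \<Rightarrow> 'a \<Rightarrow> bool) \<Rightarrow> (int \<Rightarrow> 'a \<Rightarrow> bool) \<Rightarrow> int \<Rightarrow> 'a \<Rightarrow> bool" where
  "bsc_output X N i \<omega> = (X i \<omega> \<noteq> N i \<omega>)"

section \<open>Entropy rate\<close>

text \<open>The Shannon entropy, in nats, of the word at times \<open>-n\<close>, ..., \<open>0\<close>; see \<open>block_entropy_eq\<close> below
  for the explicit sum.\<close>

definition block_entropy :: "'a measure \<Rightarrow> (int \<Rightarrow> 'a \<Rightarrow> bool) \<Rightarrow> nat \<Rightarrow> real" where
  "block_entropy M W n =
     prob_space.entropy M (exp 1) (count_space (block W (- int n) (n + 1) ` space M))
       (block W (- int n) (n + 1))"

definition entropy_rate :: "'a measure \<Rightarrow> (int \<Rightarrow> 'a \<Rightarrow> bool) \<Rightarrow> real" where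
  "entropy_rate M W = lim (\<lambda>n. block_entropy M W n / real (n + 1))"

section \<open>The coefficients\<close>

definition word_prob :: "'a measure \<Rightarrow> (int \<Rightarrow> 'a \<Rightarrow> bool) \<Rightarrow> bool list \<Rightarrow> real" where
  "word_prob M X u = \<P>(\<omega> in M. block X (1 - int (length u)) (length u) \<omega> = u)"

definition next_prob :: "'a measure \<Rightarrow> (int \<Rightarrow> 'a \<Rightarrow> bool) \<Rightarrow> bool \<Rightarrow> bool list \<Rightarrow> real" where
  "next_prob M X v w = word_prob M X (w @ [v]) / word_prob M X w"

definition allowed_words :: "'a measure \<Rightarrow> (int \<Rightarrow> 'a \<Rightarrow> bool) \<Rightarrow> bool list set" where
  "allowed_words M X = {u. word_prob M X u > 0}"

text \<open>The superscript \<open>k\<close> is the first numeric argument; the subscript is the length of the word.\<close>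

definition h_coeff :: "'a measure \<Rightarrow> (int \<Rightarrow> 'a \<Rightarrow> bool) \<Rightarrow> nat \<Rightarrow> bool list \<Rightarrow> real" where
  "h_coeff M X k u =
     (\<Sum>j\<in>{k..<length u}. word_prob M X (u[j := \<not> u ! j])) - real (length u - k) * word_prob M X u"

text \<open>For \<open>u\<close> starting at time \<open>-n\<close>: the probability that \<open>X\<close> shows the first \<open>k\<close> letters of \<open>u\<close> and the
  channel output shows the remaining ones. It is used with \<open>u = w\<close> and \<open>u = wv\<close>, where \<open>w\<close> has length
  \<open>n\<close>, so that \<open>u\<close> ends at time -1 and 0, respectively.\<close>

definition pXZ ::
  "'a measure \<Rightarrow> (int \<Rightarrow> 'a \<Rightarrow> bool) \<Rightarrow> (real \<Rightarrow> int \<Rightarrow> 'a \<Rightarrow> bool) \<Rightarrow>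
     nat \<Rightarrow> nat \<Rightarrow> bool list \<Rightarrow> real \<Rightarrow> real" where
  "pXZ M X E n k u \<epsilon> =
     \<P>(\<omega> in M. block X (- int n) k \<omega> = take k u \<and>
                block (bsc_output X (E \<epsilon>)) (- int n + int k) (length u - k) \<omega> = drop k u)"

definition f_coeff :: "'a measure \<Rightarrow> (int \<Rightarrow> 'a \<Rightarrow> bool) \<Rightarrow> nat \<Rightarrow> nat \<Rightarrow> real" where
  "f_coeff M X n k =
     (\<Sum>(w, v) | length w = n \<and> w \<in> allowed_words M X \<and> w @ [v] \<notin> allowed_words M X.
        h_coeff M X k (w @ [v]))"

definition g_coeff ::
  "'a measure \<Rightarrow> (int \<Rightarrow> 'a \<Rightarrow> bool) \<Rightarrow> (real \<Rightarrow> int \<Rightarrow> 'a \<Rightarrow> bool) \<Rightarrow> nat \<Rightarrow> nat \<Rightarrow> real" where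
  "g_coeff M X E n k =
     - (\<Sum>(w, v) | length w = n \<and> w @ [v] \<in> allowed_words M X.
          h_coeff M X k (w @ [v]) * ln (next_prob M X v w)
          + (h_coeff M X k (w @ [v]) * word_prob M X w - h_coeff M X k w * word_prob M X (w @ [v]))
            / word_prob M X w)
     - (\<Sum>(w, v) | length w = n \<and> w \<in> allowed_words M X \<and> w @ [v] \<notin> allowed_words M X.
          h_coeff M X k (w @ [v]) * ln (h_coeff M X k (w @ [v]) / word_prob M X w))
     - (\<Sum>(w, v) | length w = n \<and>
            pXZ M X E n k w \<in> \<Theta>[at_right 0](\<lambda>\<epsilon>. \<epsilon>) \<and> pXZ M X E n k (w @ [v]) \<in> \<Theta>[at_right 0](\<lambda>\<epsilon>. \<epsilon>).
          h_coeff M X k (w @ [v]) * ln (h_coeff M X k (w @ [v]) / h_coeff M X k w))"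

section \<open>Sanity checks\<close>

lemma length_block [simp]: "length (block W t n \<omega>) = n"
  by (simp add: block_def)

lemma finite_words: "finite {w :: bool list. length w = n}"
  using finite_lists_length_eq[of "UNIV :: bool set" n] by simp

text \<open>The sums in \<open>f_coeff\<close> and \<open>g_coeff\<close> range over finite sets.\<close>

lemma finite_word_letter_pairs: "finite {(w :: bool list, v :: bool). length w = n \<and> P w v}"
proof (rule finite_subset)
  show "{(w, v). length w = n \<and> P w v} \<subseteq> {w. length w = n} \<times> UNIV" by auto
  show "finite ({w :: bool list. length w = n} \<times> (UNIV :: bool set))"
    by (intro finite_cartesian_product finite_words) simp
qed

lemma measurable_block:
  assumes "\<And>j. j < n \<Longrightarrow> W (t + int j) \<in> M \<rightarrow>\<^sub>M count_space UNIV"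
  shows "block W t n \<in> M \<rightarrow>\<^sub>M count_space UNIV"
proof -
  have "block W t n -` {u} \<inter> space M \<in> sets M" for u
  proof -
    have iff: "block W t n \<omega> = u \<longleftrightarrow> length u = n \<and> (\<forall>j\<in>{..<n}. W (t + int j) \<omega> = u ! j)" for \<omega>
      unfolding list_eq_iff_nth_eq[of "block W t n \<omega>" u] length_block
      by (simp add: block_def Ball_def cong: conj_cong) blast
    have "block W t n -` {u} \<inter> space M =
          {\<omega>\<in>space M. length u = n \<and> (\<forall>j\<in>{..<n}. W (t + int j) \<omega> = u ! j)}"
      unfolding iff[symmetric] by blast
    also have "\<dots> \<in> sets M"
    proof (rule sets.sets_Collect_conj[OF sets.sets_Collect_countable_All' sets.sets_Collect_const])
      show "{\<omega> \<in> space M. W (t + int j) \<omega> = u ! j} \<in> sets M" if "j \<in> {..<n}" for j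
      proof -
        have "W (t + int j) -` {u ! j} \<inter> space M \<in> sets M"
          using assms that by (intro measurable_sets[of _ M "count_space UNIV"]) simp_all
        moreover have "W (t + int j) -` {u ! j} \<inter> space M = {\<omega> \<in> space M. W (t + int j) \<omega> = u ! j}"
          by blast
        ultimately show ?thesis by simp
      qed
    qed simp
    finally show ?thesis .
  qed
  then show ?thesis
    by (subst measurable_count_space_eq2_countable) simp_all
qed

lemma block_entropy_eq:
  assumes "prob_space M" and "binary_process M W"
  shows "block_entropy M W n =
    - (\<Sum>u | length u = n + 1. \<P>(\<omega> in M. block W (- int n) (n + 1) \<omega> = u)
                             * ln (\<P>(\<omega> in M. block W (- int n) (n + 1) \<omega> = u)))"
proof -
  interpret prob_space M by fact
  interpret information_space M "exp 1" by unfold_locales simp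
  define B where "B = block W (- int n) (n + 1)"
  define p where "p u = prob {\<omega> \<in> space M. B \<omega> = u}" for u
  have vim: "B -` {u} \<inter> space M = {\<omega> \<in> space M. B \<omega> = u}" for u by blast
  have img: "B ` space M \<subseteq> {u. length u = n + 1}" by (auto simp: B_def)
  then have fin: "finite (B ` space M)" using finite_words finite_subset by blast
  have meas: "B \<in> M \<rightarrow>\<^sub>M count_space UNIV"
    unfolding B_def
  proof (rule measurable_block)
    fix j assume "j < n + 1"
    then have "- int n + int j \<le> 0" by linarith
    then show "W (- int n + int j) \<in> M \<rightarrow>\<^sub>M count_space UNIV"
      using assms(2) unfolding binary_process_def by blast
  qed
  have "simple_function M B"
    unfolding simple_function_def using fin measurable_sets[OF meas] by simp
  then have "simple_distributed M B p"
    by (rule simple_distributedI) (simp_all add: p_def vim)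
  then have "entropy (exp 1) (count_space (B ` space M)) B
      = - (\<Sum>u\<in>B ` space M. p u * log (exp 1) (p u))"
    by (rule entropy_simple_distributed)
  also have "\<dots> = - (\<Sum>u\<in>B ` space M. p u * ln (p u))"
    by (simp add: log_def)
  also have "(\<Sum>u\<in>B ` space M. p u * ln (p u)) = (\<Sum>u | length u = n + 1. p u * ln (p u))"
  proof (rule sum.mono_neutral_left[OF finite_words img], rule ballI)
    fix u assume "u \<in> {u. length u = n + 1} - B ` space M"
    then have "{\<omega>\<in>space M. B \<omega> = u} = {}" by blast
    then have "p u = 0" unfolding p_def by (simp only: measure_empty)
    then show "p u * ln (p u) = 0" by simp
  qed
  finally show ?thesis
    unfolding block_entropy_def p_def B_def .
qed

end

theory Submission
  imports Defs "HOL-Real_Asymp.Real_Asymp"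
begin

text \<open>
  Write \<open>F\<^sub>n\<^sup>k(\<epsilon>)\<close> for the conditional entropy of \<open>Z\<^sub>0\<close> given the preceding \<open>n\<close> letters, of which the first
  \<open>k\<close> are those of \<open>X\<close> and the others those of \<open>Z\<close>. Conditioning lowers entropy and \<open>m\<close> letters of \<open>X\<close>
  screen off the past, so \<open>F\<^sub>n\<^sup>m(\<epsilon>) \<le> H(Z\<^sub>\<epsilon>) \<le> F\<^sub>n\<^sup>0(\<epsilon>)\<close> for \<open>n \<ge> m\<close>, with equality at \<open>\<epsilon> = 0\<close>. Each
  \<open>F\<^sub>n\<^sup>k\<close> is a finite sum of terms \<open>q ln (q / r)\<close> in which \<open>q\<close> and \<open>r\<close> are polynomials in \<open>\<epsilon>\<close> with first order
  coefficients given by \<open>h\<close>, whence \<open>F\<^sub>n\<^sup>k(\<epsilon>) = H(X) + f\<^sub>n\<^sup>k \<epsilon> ln (1/\<epsilon>) + g\<^sub>n\<^sup>k \<epsilon> + O(\<epsilon>\<^sup>2 ln \<epsilon>)\<close>. The Markov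
  property gives \<open>f\<^sub>n\<^sup>0 = f\<^sub>n\<^sup>m\<close> for \<open>n \<ge> 2m\<close> and \<open>g\<^sub>n\<^sup>0 = g\<^sub>n\<^sup>m\<close> for \<open>n \<ge> 3m\<close>, so that the two bounds agree up
  to the error term; comparing the bounds for \<open>n = 2m\<close> and \<open>n = 3m\<close> shows that the leading coefficient
  is the same for both.
\<close>

section \<open>Sums over words\<close>

abbreviation words :: "nat \<Rightarrow> bool list set" where
  "words n \<equiv> {u. length u = n}"

lemma words_Suc_Cons: "words (Suc n) = (\<lambda>(a, u). a # u) ` (UNIV \<times> words n)"
  by (auto simp: length_Suc_conv image_iff)

lemma words_Suc_snoc: "words (Suc n) = (\<lambda>(u, a). u @ [a]) ` (words n \<times> UNIV)"
  by (auto simp: length_Suc_conv_rev image_iff)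

lemma words_add: "words (a + b) = (\<lambda>(u, v). u @ v) ` (words a \<times> words b)"
proof (intro equalityI subsetI)
  fix z assume "z \<in> words (a + b)"
  then have "z = (\<lambda>(u, v). u @ v) (take a z, drop a z)" "(take a z, drop a z) \<in> words a \<times> words b"
    by auto
  then show "z \<in> (\<lambda>(u, v). u @ v) ` (words a \<times> words b)" by (rule image_eqI)
qed auto

lemma sum_words_0 [simp]: "(\<Sum>u\<in>words 0. f u) = f []"
  by simp

lemma sum_words_Suc_Cons: "(\<Sum>u\<in>words (Suc n). f u) = (\<Sum>a\<in>UNIV. \<Sum>u\<in>words n. f (a # u))"
  unfolding words_Suc_Cons
  by (subst sum.reindex) (auto simp: inj_on_def sum.cartesian_product finite_words case_prod_unfold o_def)

lemma sum_words_Suc_snoc: "(\<Sum>u\<in>words (Suc n). f u) = (\<Sum>u\<in>words n. \<Sum>a\<in>UNIV. f (u @ [a]))"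
  unfolding words_Suc_snoc
  by (subst sum.reindex) (auto simp: inj_on_def sum.cartesian_product finite_words case_prod_unfold o_def)

lemma sum_words_add:
  "(\<Sum>z\<in>words (a + b). f z) = (\<Sum>u\<in>words a. \<Sum>v\<in>words b. f (u @ v))"
  unfolding words_add
  by (subst sum.reindex) (auto simp: inj_on_def sum.cartesian_product finite_words case_prod_unfold o_def)

text \<open>Turning the side condition on the index set into an \<open>if\<close> guard puts sums
  with different side conditions on one index set, where they can be merged and compared term by
  term.\<close>

lemma sum_word_letter_pairs:
  "(\<Sum>(w, v) | length w = n \<and> P w v. f w v)
     = (\<Sum>w\<in>words n. \<Sum>v\<in>(UNIV :: bool set). if P w v then f w v else (0 :: real))"
proof -
  have "(\<Sum>(w, v) | length w = n \<and> P w v. f w v)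
      = (\<Sum>(w, v)\<in>words n \<times> UNIV. if P w v then f w v else 0)"
    by (rule sum.mono_neutral_cong_left)
       (auto intro!: finite_cartesian_product finite_words split: prod.splits)
  then show ?thesis by (simp add: sum.cartesian_product)
qed

section \<open>The log-sum inequality\<close>

text \<open>In use \<open>q\<close> is the probability of \<open>wv\<close> and \<open>r\<close>
  that of \<open>w\<close>. The factor \<open>q\<close> encodes the convention for vanishing
  probabilities.\<close>

definition entropy_term :: "real \<Rightarrow> real \<Rightarrow> real" where
  "entropy_term q r = q * ln (q / r)"

lemma entropy_term_0 [simp]: "entropy_term 0 r = 0"
  by (simp add: entropy_term_def)

lemma entropy_term_scale:
  assumes "c \<noteq> 0 \<or> (q = 0 \<and> r = 0)"
  shows "entropy_term (c * q) (c * r) = c * entropy_term q r"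
  using assms by (auto simp: entropy_term_def)

text \<open>This is the convexity behind "conditioning lowers entropy". The hypothesis
  \<open>a i \<le> b i\<close> holds for a word and its prefix, and makes \<open>b i\<close>
  positive wherever \<open>a i\<close> is.\<close>

lemma log_sum_inequality:
  assumes fin: "finite I"
    and a: "\<And>i. i \<in> I \<Longrightarrow> 0 \<le> a i" and ab: "\<And>i. i \<in> I \<Longrightarrow> a i \<le> b i"
  shows "entropy_term (\<Sum>i\<in>I. a i) (\<Sum>i\<in>I. b i) \<le> (\<Sum>i\<in>I. entropy_term (a i) (b i))"
proof (cases "(\<Sum>i\<in>I. a i) = 0")
  case True
  then have "a i = 0" if "i \<in> I" for i
    using that sum_nonneg_eq_0_iff[OF fin, of a] a by blast
  then show ?thesis using True by simp
next
  case False
  define A B where "A = (\<Sum>i\<in>I. a i)" and "B = (\<Sum>i\<in>I. b i)"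
  have A: "A > 0" using False a unfolding A_def by (simp add: sum_nonneg order.not_eq_order_implies_strict)
  have B: "B > 0" using A ab unfolding A_def B_def by (meson order_less_le_trans sum_mono)
  \<comment> \<open>The tangent bound \<open>ln x \<le> x - 1\<close> at the quotient of
    \<open>A / B\<close> by \<open>a i / b i\<close>; the linear terms
    \<open>a i - b i * A / B\<close> cancel on summation.\<close>
  have bound: "a i * ln (A / B) + a i - b i * A / B \<le> entropy_term (a i) (b i)" if i: "i \<in> I" for i
  proof (cases "a i = 0")
    case True
    then show ?thesis using a[OF i] ab[OF i] A B by simp
  next
    case False
    then have ai: "a i > 0" and bi: "b i > 0" using a[OF i] ab[OF i] by linarith+
    have "ln ((b i * A) / (a i * B)) \<le> (b i * A) / (a i * B) - 1"
      using ai bi A B by (intro ln_le_minus_one) simp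
    also have "ln ((b i * A) / (a i * B)) = ln (A / B) - ln (a i / b i)"
      using ai bi A B by (simp add: ln_div ln_mult)
    finally have "a i * (ln (A / B) - ln (a i / b i)) \<le> a i * ((b i * A) / (a i * B) - 1)"
      using ai by (simp add: mult_left_mono)
    also have "\<dots> = b i * A / B - a i" using ai B by (simp add: field_simps)
    finally show ?thesis by (simp add: entropy_term_def algebra_simps)
  qed
  have "entropy_term A B = (\<Sum>i\<in>I. a i * ln (A / B) + a i - b i * A / B)"
    using B by (simp add: entropy_term_def sum_subtractf sum.distrib A_def B_def
        flip: sum_distrib_right sum_divide_distrib)
  also have "\<dots> \<le> (\<Sum>i\<in>I. entropy_term (a i) (b i))" by (intro sum_mono bound)
  finally show ?thesis unfolding A_def B_def .
qed

section \<open>Entropy rate of a stationary word distribution\<close>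

text \<open>Defined for any weight on words, because it is also applied to
  \<open>obs m \<epsilon>\<close>, which mixes source and output letters and is in general not shift
  invariant.\<close>

definition cond_ent :: "(bool list \<Rightarrow> real) \<Rightarrow> nat \<Rightarrow> real" where
  "cond_ent r n = - (\<Sum>w\<in>words n. \<Sum>v\<in>UNIV. entropy_term (r (w @ [v])) (r w))"

lemma cesaro_decreasing:
  fixes h :: "nat \<Rightarrow> real"
  assumes dec: "decseq h" and lim: "h \<longlonglongrightarrow> L"
  shows "(\<lambda>n. (\<Sum>i\<le>n. h i) / real (n + 1)) \<longlonglongrightarrow> L"
proof (rule LIMSEQ_I)
  fix e :: real assume e: "e > 0"
  have ge: "L \<le> h i" for i using decseq_ge[OF dec lim] .
  obtain N where N: "\<And>n. n \<ge> N \<Longrightarrow> \<bar>h n - L\<bar> < e / 2"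
    using LIMSEQ_D[OF lim, of "e / 2"] e by auto
  define S where "S = (\<Sum>i<N. h i - L)"
  have S0: "S \<ge> 0" unfolding S_def using ge by (intro sum_nonneg) (simp add: diff_ge_0_iff_ge)
  \<comment> \<open>From \<open>N'\<close> on, the fixed excess \<open>S\<close> of the first
    \<open>N\<close> terms weighs less than \<open>e / 2\<close> in the average. Monotonicity makes
    all \<open>h i - L\<close> nonnegative, so bounding their sum from above suffices.\<close>
  obtain N' :: nat where N': "real N' > 2 * S / e" using reals_Archimedean2 by blast
  show "\<exists>no. \<forall>n\<ge>no. norm ((\<Sum>i\<le>n. h i) / real (n + 1) - L) < e"
  proof (intro exI allI impI)
    fix n assume n: "n \<ge> max N N'"
    have "(\<Sum>i\<le>n. h i - L) \<le> S + (\<Sum>i\<in>{N..n}. e / 2)"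
    proof -
      have "{..n} = {..<N} \<union> {N..n}" using n by auto
      then have "(\<Sum>i\<le>n. h i - L) = S + (\<Sum>i\<in>{N..n}. h i - L)"
        unfolding S_def by (simp only:, subst sum.union_disjoint) auto
      also have "(\<Sum>i\<in>{N..n}. h i - L) \<le> (\<Sum>i\<in>{N..n}. e / 2)"
        proof (intro sum_mono)
          fix i assume "i \<in> {N..n}"
          then have "\<bar>h i - L\<bar> < e / 2" using N by simp
          then show "h i - L \<le> e / 2" by linarith
        qed
      finally show ?thesis by simp
    qed
    also have "(\<Sum>i\<in>{N..n}. e / 2) \<le> real (n + 1) * (e / 2)"
      using e by (simp add: mult_right_mono)
    finally have u: "(\<Sum>i\<le>n. h i - L) \<le> S + real (n + 1) * (e / 2)" by simp
    have "2 * S / e < real (n + 1)" using N' n by simp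
    then have "S < real (n + 1) * (e / 2)" using e by (simp add: field_simps)
    with u have "(\<Sum>i\<le>n. h i - L) < real (n + 1) * e" by simp
    moreover have "(\<Sum>i\<le>n. h i - L) \<ge> 0" using ge by (intro sum_nonneg) simp
    moreover have "(\<Sum>i\<le>n. h i) / real (n + 1) - L = (\<Sum>i\<le>n. h i - L) / real (n + 1)"
      by (simp add: sum_subtractf field_simps)
    ultimately show "norm ((\<Sum>i\<le>n. h i) / real (n + 1) - L) < e"
      by (simp add: divide_less_eq mult.commute)
  qed
qed

text \<open>The finite-dimensional laws alone: \<open>sum_snoc\<close> is consistency, and
  \<open>sum_Cons\<close> adds stationarity, since dropping the first letter moves the block by one
  time step.\<close>

locale stationary_words =
  fixes r :: "bool list \<Rightarrow> real"
  assumes nonneg: "0 \<le> r u"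
    and empty_word: "r [] = 1"
    and sum_snoc: "(\<Sum>v\<in>UNIV. r (u @ [v])) = r u"
    and sum_Cons: "(\<Sum>a\<in>UNIV. r (a # u)) = r u"
begin

lemma snoc_le: "r (u @ [v]) \<le> r u"
proof -
  have "r (u @ [v]) \<le> (\<Sum>v\<in>UNIV. r (u @ [v]))" by (rule member_le_sum) (auto simp: nonneg)
  then show ?thesis by (simp add: sum_snoc)
qed

lemma Cons_le: "r (a # u) \<le> r u"
proof -
  have "r (a # u) \<le> (\<Sum>a\<in>UNIV. r (a # u))" by (rule member_le_sum) (auto simp: nonneg)
  then show ?thesis by (simp add: sum_Cons)
qed

lemma append_le_left: "r (u @ s) \<le> r u"
proof (induction s rule: rev_induct)
  case (snoc v s)
  have "r (u @ s @ [v]) \<le> r (u @ s)" using snoc_le[of "u @ s" v] by simp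
  then show ?case using snoc by linarith
qed simp

lemma append_le_right: "r (u @ s) \<le> r s"
proof (induction u)
  case (Cons a u)
  then show ?case using Cons_le[of a "u @ s"] by simp
qed simp

lemma sum_append_left: "(\<Sum>u\<in>words n. r (u @ s)) = r s"
proof (induction n)
  case (Suc n)
  have "(\<Sum>u\<in>words (Suc n). r (u @ s)) = (\<Sum>u\<in>words n. \<Sum>a\<in>UNIV. r (a # u @ s))"
    by (subst sum_words_Suc_Cons, subst sum.swap) simp
  then show ?case using Suc by (simp add: sum_Cons)
qed simp

lemma cond_ent_nonneg: "0 \<le> cond_ent r n"
proof -
  have "entropy_term (r (w @ [v])) (r w) \<le> 0" for w v
  proof (cases "r (w @ [v]) = 0")
    case False
    then have "0 < r (w @ [v])" using nonneg[of "w @ [v]"] by simp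
    then show ?thesis using snoc_le[of w v]
      by (auto simp: entropy_term_def mult_le_0_iff intro!: ln_le_zero_iff[THEN iffD2])
  qed simp
  then show ?thesis unfolding cond_ent_def by (simp add: sum_nonpos)
qed

text \<open>By \<open>sum_Cons\<close>, the weights of \<open>w\<close> and \<open>wv\<close> are
  sums over one earlier letter; the log-sum inequality compares them with the separate
  terms.\<close>

lemma cond_ent_decseq: "decseq (cond_ent r)"
proof (rule decseq_SucI)
  fix n
  have "(\<Sum>w\<in>words n. \<Sum>v\<in>UNIV. entropy_term (r (w @ [v])) (r w))
     = (\<Sum>w\<in>words n. \<Sum>v\<in>UNIV. entropy_term (\<Sum>a\<in>UNIV. r (a # w @ [v])) (\<Sum>a\<in>UNIV. r (a # w)))"
    by (simp only: sum_Cons)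
  also have "\<dots> \<le> (\<Sum>w\<in>words n. \<Sum>v\<in>UNIV. \<Sum>a\<in>UNIV. entropy_term (r (a # w @ [v])) (r (a # w)))"
    by (intro sum_mono log_sum_inequality)
       (auto simp: nonneg intro: snoc_le[of "_ # _", simplified])
  also have "\<dots> = (\<Sum>w\<in>words n. \<Sum>a\<in>UNIV. \<Sum>v\<in>UNIV. entropy_term (r (a # w @ [v])) (r (a # w)))"
    by (intro sum.cong refl sum.swap)
  also have "\<dots> = (\<Sum>w\<in>words (Suc n). \<Sum>v\<in>UNIV. entropy_term (r (w @ [v])) (r w))"
    unfolding sum_words_Suc_Cons append_Cons by (rule sum.swap)
  finally show "cond_ent r (Suc n) \<le> cond_ent r n" by (simp add: cond_ent_def)
qed

definition rate :: real where
  "rate = lim (\<lambda>n. - (\<Sum>u\<in>words (n + 1). r u * ln (r u)) / real (n + 1))"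

text \<open>The chain rule for entropy. It starts from zero because the empty word has probability
  1.\<close>

lemma block_entropy_eq_sum_cond_ent:
  "- (\<Sum>u\<in>words (n + 1). r u * ln (r u)) = (\<Sum>i\<le>n. cond_ent r i)"
proof -
  define H where "H n = - (\<Sum>u\<in>words n. r u * ln (r u))" for n
  have step: "H (Suc n) = H n + cond_ent r n" for n
  proof -
    have "r (w @ [v]) * ln (r (w @ [v]))
        = entropy_term (r (w @ [v])) (r w) + r (w @ [v]) * ln (r w)" for w v
    proof (cases "r (w @ [v]) = 0")
      case False
      then have "0 < r (w @ [v])" "0 < r w"
        using nonneg[of "w @ [v]"] snoc_le[of w v] by linarith+
      then show ?thesis by (simp add: entropy_term_def ln_div algebra_simps)
    qed simp
    then have "(\<Sum>u\<in>words (Suc n). r u * ln (r u))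
        = (\<Sum>w\<in>words n. \<Sum>v\<in>UNIV. entropy_term (r (w @ [v])) (r w) + r (w @ [v]) * ln (r w))"
      unfolding sum_words_Suc_snoc by presburger
    also have "\<dots> = - cond_ent r n + (\<Sum>w\<in>words n. r w * ln (r w))"
      unfolding cond_ent_def sum.distrib by (simp only: sum_snoc minus_minus flip: sum_distrib_right)
    finally show ?thesis by (simp add: H_def)
  qed
  have "H (Suc n) = (\<Sum>i\<le>n. cond_ent r i)"
  proof (induction n)
    case 0
    show ?case using step[of 0] by (simp add: H_def empty_word)
  next
    case (Suc n)
    show ?case using step[of "Suc n"] Suc by simp
  qed
  then show ?thesis by (simp add: H_def)
qed

text \<open>The conditional entropies decrease and are nonnegative, hence converge; the block
  entropies per letter are their Cesaro means. This also shows that the \<open>lim\<close> in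
  \<open>rate_def\<close> is a genuine limit.\<close>

lemma cond_ent_tendsto_rate: "cond_ent r \<longlonglongrightarrow> rate"
proof -
  obtain L where L: "cond_ent r \<longlonglongrightarrow> L"
    using decseq_convergent[OF cond_ent_decseq, of 0] cond_ent_nonneg by blast
  have "rate = L"
    unfolding rate_def block_entropy_eq_sum_cond_ent
    by (rule limI[OF cesaro_decreasing[OF cond_ent_decseq L]])
  then show ?thesis using L by simp
qed

lemma rate_le_cond_ent: "rate \<le> cond_ent r n"
  by (rule decseq_ge[OF cond_ent_decseq cond_ent_tendsto_rate])

end

section \<open>Asymptotic expansions at zero\<close>

text \<open>The error is quadratic rather than merely of smaller order than
  \<open>\<epsilon>\<close>, as the error term of the theorem demands.\<close>

definition first_order :: "(real \<Rightarrow> real) \<Rightarrow> real \<Rightarrow> real \<Rightarrow> bool" where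
  "first_order f a b \<longleftrightarrow> (\<lambda>\<epsilon>. f \<epsilon> - (a + b * \<epsilon>)) \<in> O[at_right 0](\<lambda>\<epsilon>. \<epsilon>\<^sup>2)"

lemma bigo_eventually_eq:
  fixes f :: "'c \<Rightarrow> real"
  assumes "eventually (\<lambda>x. f x = f' x) F" and "f' \<in> O[F](h)"
  shows "f \<in> O[F](h)"
  using landau_o.big.in_cong[OF assms(1)] assms(2) by simp

lemma bigo_sandwich:
  fixes f g h :: "real \<Rightarrow> real"
  assumes f: "f \<in> O[F](k)" and h: "h \<in> O[F](k)" and "\<forall>\<^sub>F x in F. f x \<le> g x \<and> g x \<le> h x"
  shows "g \<in> O[F](k)"
proof -
  have "g \<in> O[F](\<lambda>x. \<bar>f x\<bar> + \<bar>h x\<bar>)"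
    by (rule bigoI[of _ 1]) (use assms(3) in eventually_elim, auto)
  also have "(\<lambda>x. \<bar>f x\<bar> + \<bar>h x\<bar>) \<in> O[F](k)" using f h by (intro sum_in_bigo) simp_all
  finally show ?thesis .
qed

lemma eps_bigo_one: "(\<lambda>\<epsilon>::real. \<epsilon>) \<in> O[at_right 0](\<lambda>_. 1)"
  by (rule bigoI[of _ 1]) (auto simp: eventually_at intro!: exI[of _ 1])

lemma eps2_bigo_eps: "(\<lambda>\<epsilon>::real. \<epsilon>\<^sup>2) \<in> O[at_right 0](\<lambda>\<epsilon>. \<epsilon>)"
  using landau_o.big.mult[OF eps_bigo_one landau_o.big_refl[of "\<lambda>\<epsilon>::real. \<epsilon>"]]
  by (simp add: power2_eq_square)

lemma one_bigo_ln: "(\<lambda>_. 1) \<in> O[at_right 0](\<lambda>\<epsilon>::real. ln \<epsilon>)"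
proof (rule bigoI[of _ 1])
  have "ln \<epsilon> \<le> -1" if "0 < \<epsilon>" "\<epsilon> < exp (- 1)" for \<epsilon> :: real
    using that by (metis exp_gt_zero ln_exp ln_le_cancel_iff less_imp_le)
  then show "\<forall>\<^sub>F \<epsilon>::real in at_right 0. norm (1::real) \<le> 1 * norm (ln \<epsilon>)"
    by (force simp: eventually_at dist_real_def intro!: exI[of _ "exp (-1) :: real"])
qed

lemma eps2_bigo_eps2_ln: "(\<lambda>\<epsilon>::real. \<epsilon>\<^sup>2) \<in> O[at_right 0](\<lambda>\<epsilon>. \<epsilon>\<^sup>2 * ln \<epsilon>)"
  using landau_o.big.mult[OF landau_o.big_refl[of "\<lambda>\<epsilon>::real. \<epsilon>\<^sup>2"] one_bigo_ln] by simp

lemma eps2_ln_bigo_eps: "(\<lambda>\<epsilon>::real. \<epsilon>\<^sup>2 * ln \<epsilon>) \<in> O[at_right 0](\<lambda>\<epsilon>. \<epsilon>)"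
  by real_asymp

text \<open>Serves to compare leading coefficients. Since \<open>\<epsilon>\<close> is of smaller
  order than \<open>\<epsilon> * ln (1 / \<epsilon>)\<close>, a nonzero \<open>c\<close> would make
  \<open>\<epsilon>\<close> of smaller order than itself.\<close>

lemma eps_ln_not_bigo_eps:
  assumes "(\<lambda>\<epsilon>::real. c * (\<epsilon> * ln (1 / \<epsilon>))) \<in> O[at_right 0](\<lambda>\<epsilon>. \<epsilon>)"
  shows "c = 0"
proof (rule ccontr)
  assume "c \<noteq> 0"
  then have "(\<lambda>\<epsilon>::real. \<epsilon> * ln (1 / \<epsilon>)) \<in> O[at_right 0](\<lambda>\<epsilon>. \<epsilon>)" using assms by simp
  moreover have "(\<lambda>\<epsilon>::real. \<epsilon>) \<in> o[at_right 0](\<lambda>\<epsilon>. \<epsilon> * ln (1 / \<epsilon>))" by real_asymp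
  ultimately have "(\<lambda>\<epsilon>::real. \<epsilon>) \<in> o[at_right 0](\<lambda>\<epsilon>. \<epsilon>)"
    using landau_o.small_big_trans by blast
  then have "\<forall>\<^sub>F \<epsilon>::real in at_right 0. \<epsilon> = 0" by (simp add: landau_o.small_refl_iff)
  moreover have "\<forall>\<^sub>F \<epsilon>::real in at_right 0. \<epsilon> \<noteq> 0" by (auto simp: eventually_at intro!: exI[of _ 1])
  ultimately have "\<forall>\<^sub>F \<epsilon>::real in at_right 0. False" by eventually_elim simp
  then show False by simp
qed

lemma first_order_const: "first_order (\<lambda>_. a) a 0"
  by (simp add: first_order_def)

lemma first_order_id: "first_order (\<lambda>\<epsilon>. \<epsilon>) 0 1"
  by (simp add: first_order_def)

lemma first_order_add:
  assumes "first_order f a b" "first_order g c d"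
  shows "first_order (\<lambda>\<epsilon>. f \<epsilon> + g \<epsilon>) (a + c) (b + d)"
  using sum_in_bigo(1)[OF assms[unfolded first_order_def]]
  by (simp add: first_order_def algebra_simps)

lemma first_order_diff:
  assumes "first_order f a b" "first_order g c d"
  shows "first_order (\<lambda>\<epsilon>. f \<epsilon> - g \<epsilon>) (a - c) (b - d)"
  using sum_in_bigo(2)[OF assms[unfolded first_order_def]]
  by (simp add: first_order_def algebra_simps)

lemma affine_bigo_one: "(\<lambda>\<epsilon>::real. a + b * \<epsilon>) \<in> O[at_right 0](\<lambda>_. 1)"
  by (intro sum_in_bigo) (auto intro: landau_o.big.mult_in_1 eps_bigo_one)

lemma first_order_zero_order:
  assumes "first_order f a b"
  shows "(\<lambda>\<epsilon>. f \<epsilon> - a) \<in> O[at_right 0](\<lambda>\<epsilon>. \<epsilon>)"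
proof -
  have "(\<lambda>\<epsilon>. (f \<epsilon> - (a + b * \<epsilon>)) + b * \<epsilon>) \<in> O[at_right 0](\<lambda>\<epsilon>. \<epsilon>)"
    by (rule sum_in_bigo(1)[OF landau_o.big_trans[OF assms[unfolded first_order_def] eps2_bigo_eps]]) simp
  then show ?thesis by (simp add: algebra_simps)
qed

lemma zero_order_bigo_one:
  assumes "(\<lambda>\<epsilon>. f \<epsilon> - a) \<in> O[at_right 0](\<lambda>\<epsilon>::real. \<epsilon>)"
  shows "f \<in> O[at_right 0](\<lambda>_. 1)"
proof -
  have "(\<lambda>\<epsilon>. (f \<epsilon> - a) + a) \<in> O[at_right 0](\<lambda>_. 1)"
    by (rule sum_in_bigo(1)[OF landau_o.big_trans[OF assms eps_bigo_one]]) simp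
  then show ?thesis by simp
qed

lemma first_order_mult:
  assumes f: "first_order f a b" and g: "first_order g c d"
  shows "first_order (\<lambda>\<epsilon>. f \<epsilon> * g \<epsilon>) (a * c) (a * d + b * c)"
proof -
  have "(\<lambda>\<epsilon>. (f \<epsilon> - (a + b * \<epsilon>)) * g \<epsilon>) \<in> O[at_right 0](\<lambda>\<epsilon>. \<epsilon>\<^sup>2 * 1)"
    by (rule landau_o.big.mult[OF f[unfolded first_order_def]
          zero_order_bigo_one[OF first_order_zero_order[OF g]]])
  moreover have "(\<lambda>\<epsilon>. (a + b * \<epsilon>) * (g \<epsilon> - (c + d * \<epsilon>))) \<in> O[at_right 0](\<lambda>\<epsilon>. 1 * \<epsilon>\<^sup>2)"
    by (rule landau_o.big.mult[OF affine_bigo_one g[unfolded first_order_def]])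
  ultimately have "(\<lambda>\<epsilon>. (f \<epsilon> - (a + b * \<epsilon>)) * g \<epsilon> + (a + b * \<epsilon>) * (g \<epsilon> - (c + d * \<epsilon>))
      + (b * d) * \<epsilon>\<^sup>2) \<in> O[at_right 0](\<lambda>\<epsilon>. \<epsilon>\<^sup>2)"
    by (intro sum_in_bigo) auto
  then show ?thesis by (simp add: first_order_def algebra_simps power2_eq_square)
qed

lemma ln_one_plus_bigo:
  assumes x: "x \<in> O[at_right 0](\<lambda>\<epsilon>::real. \<epsilon>)"
  shows "(\<lambda>\<epsilon>. ln (1 + x \<epsilon>) - x \<epsilon>) \<in> O[at_right 0](\<lambda>\<epsilon>. \<epsilon>\<^sup>2)"
proof -
  have "((\<lambda>\<epsilon>. \<epsilon>) \<longlongrightarrow> (0::real)) (at_right 0)" by (rule tendsto_ident_at)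
  then have "(\<lambda>\<epsilon>::real. \<epsilon>) \<in> o[at_right 0](\<lambda>_. 1)" by (intro smalloI_tendsto) auto
  then have "x \<in> o[at_right 0](\<lambda>_. 1)" by (rule landau_o.big_small_trans[OF x])
  then have "(x \<longlongrightarrow> 0) (at_right 0)" using smalloD_tendsto by fastforce
  then have "\<forall>\<^sub>F \<epsilon> in at_right 0. \<bar>x \<epsilon>\<bar> < 1 / 2"
    using tendstoD[of x 0 "at_right 0" "1 / 2"] by (simp add: dist_real_def)
  then have "\<forall>\<^sub>F \<epsilon> in at_right 0. norm (ln (1 + x \<epsilon>) - x \<epsilon>) \<le> 2 * norm ((x \<epsilon>)\<^sup>2)"
    by eventually_elim (use abs_ln_one_plus_x_minus_x_bound in force)
  then have "(\<lambda>\<epsilon>. ln (1 + x \<epsilon>) - x \<epsilon>) \<in> O[at_right 0](\<lambda>\<epsilon>. (x \<epsilon>)\<^sup>2)" by (rule bigoI)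
  also have "(\<lambda>\<epsilon>. (x \<epsilon>)\<^sup>2) \<in> O[at_right 0](\<lambda>\<epsilon>. \<epsilon>\<^sup>2)"
    unfolding power2_eq_square by (rule landau_o.big.mult[OF x x])
  finally show ?thesis .
qed

lemma eventually_pos:
  assumes "(\<lambda>\<epsilon>. f \<epsilon> - a) \<in> O[at_right 0](\<lambda>\<epsilon>::real. \<epsilon>)" and "a > 0"
  shows "\<forall>\<^sub>F \<epsilon> in at_right 0. f \<epsilon> > 0"
proof -
  have "((\<lambda>\<epsilon>. \<epsilon>) \<longlongrightarrow> (0::real)) (at_right 0)" by (rule tendsto_ident_at)
  then have "(\<lambda>\<epsilon>::real. \<epsilon>) \<in> o[at_right 0](\<lambda>_. 1)" by (intro smalloI_tendsto) auto
  then have "(\<lambda>\<epsilon>. f \<epsilon> - a) \<in> o[at_right 0](\<lambda>_. 1)" by (rule landau_o.big_small_trans[OF assms(1)])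
  then have "((\<lambda>\<epsilon>. f \<epsilon> - a) \<longlongrightarrow> 0) (at_right 0)" using smalloD_tendsto by fastforce
  then have "(f \<longlongrightarrow> a) (at_right 0)" by (simp add: LIM_zero_iff)
  then show ?thesis using order_tendstoD(1) assms(2) by blast
qed

text \<open>Accuracy of order \<open>\<epsilon>\<close> is assumed, not a full first-order
  expansion, because that is what remains of one after division by \<open>\<epsilon>\<close>; see
  \<open>first_order_divide_eps\<close>.\<close>

lemma zero_order_ln:
  assumes f: "(\<lambda>\<epsilon>. f \<epsilon> - a) \<in> O[at_right 0](\<lambda>\<epsilon>::real. \<epsilon>)" and a: "a > 0"
  shows "(\<lambda>\<epsilon>. ln (f \<epsilon>) - ln a) \<in> O[at_right 0](\<lambda>\<epsilon>. \<epsilon>)"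
    and "(\<lambda>\<epsilon>. ln (f \<epsilon>) - (ln a + (f \<epsilon> - a) / a)) \<in> O[at_right 0](\<lambda>\<epsilon>. \<epsilon>\<^sup>2)"
proof -
  let ?x = "\<lambda>\<epsilon>. (f \<epsilon> - a) / a"
  have x: "?x \<in> O[at_right 0](\<lambda>\<epsilon>. \<epsilon>)" using f a by simp
  have ev: "\<forall>\<^sub>F \<epsilon> in at_right 0. ln (1 + ?x \<epsilon>) = ln (f \<epsilon>) - ln a"
    using eventually_pos[OF f a]
  proof eventually_elim
    case (elim \<epsilon>)
    have "1 + ?x \<epsilon> = f \<epsilon> / a" using a by (simp add: field_simps)
    then show ?case using elim a by (simp add: ln_div)
  qed
  have "(\<lambda>\<epsilon>. (ln (1 + ?x \<epsilon>) - ?x \<epsilon>) + ?x \<epsilon>) \<in> O[at_right 0](\<lambda>\<epsilon>. \<epsilon>)"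
    by (intro sum_in_bigo x landau_o.big_trans[OF ln_one_plus_bigo[OF x] eps2_bigo_eps])
  then have "(\<lambda>\<epsilon>. ln (1 + ?x \<epsilon>)) \<in> O[at_right 0](\<lambda>\<epsilon>. \<epsilon>)" by simp
  moreover have "\<forall>\<^sub>F \<epsilon> in at_right 0. ln (f \<epsilon>) - ln a = ln (1 + ?x \<epsilon>)"
    using ev by eventually_elim simp
  ultimately show "(\<lambda>\<epsilon>. ln (f \<epsilon>) - ln a) \<in> O[at_right 0](\<lambda>\<epsilon>. \<epsilon>)"
    by (rule bigo_eventually_eq[rotated])
  have "\<forall>\<^sub>F \<epsilon> in at_right 0. ln (f \<epsilon>) - (ln a + ?x \<epsilon>) = ln (1 + ?x \<epsilon>) - ?x \<epsilon>"
    using ev by eventually_elim simp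
  then show "(\<lambda>\<epsilon>. ln (f \<epsilon>) - (ln a + ?x \<epsilon>)) \<in> O[at_right 0](\<lambda>\<epsilon>. \<epsilon>\<^sup>2)"
    using ln_one_plus_bigo[OF x] by (rule bigo_eventually_eq)
qed

lemma first_order_ln:
  assumes f: "first_order f a b" and a: "a > 0"
  shows "first_order (\<lambda>\<epsilon>. ln (f \<epsilon>)) (ln a) (b / a)"
proof -
  have "(\<lambda>\<epsilon>. (f \<epsilon> - (a + b * \<epsilon>)) / a) \<in> O[at_right 0](\<lambda>\<epsilon>. \<epsilon>\<^sup>2)"
    using f a by (simp add: first_order_def)
  from sum_in_bigo(1)[OF zero_order_ln(2)[OF first_order_zero_order[OF f] a] this]
  show ?thesis using a by (simp add: first_order_def diff_divide_distrib add_divide_distrib algebra_simps)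
qed

lemma first_order_divide_eps:
  assumes "first_order f 0 b"
  shows "(\<lambda>\<epsilon>. f \<epsilon> / \<epsilon> - b) \<in> O[at_right 0](\<lambda>\<epsilon>. \<epsilon>)"
proof -
  have "(\<lambda>\<epsilon>. (f \<epsilon> - b * \<epsilon>) / \<epsilon>) \<in> O[at_right 0](\<lambda>\<epsilon>. \<epsilon>\<^sup>2 / \<epsilon>)"
    using assms by (intro landau_o.big.divide_right)
      (auto simp: first_order_def eventually_at intro!: exI[of _ 1])
  then show ?thesis
    by (rule landau_o.big.cong_ex[THEN iffD1, rotated -1])
       (auto simp: eventually_at power2_eq_square diff_divide_distrib intro!: exI[of _ 1])
qed

section \<open>Expansion of \<open>q ln (q / r)\<close> according to which of \<open>q\<close> and
  \<open>r\<close> vanish at zero\<close>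

lemma entropy_term_expansion_pos:
  assumes Q: "first_order Q a b" and R: "first_order R a' b'" and a: "a > 0" "a' > 0"
  shows "first_order (\<lambda>\<epsilon>. entropy_term (Q \<epsilon>) (R \<epsilon>)) (entropy_term a a')
           (b * ln (a / a') + (b * a' - b' * a) / a')"
proof -
  have main: "first_order (\<lambda>\<epsilon>. Q \<epsilon> * (ln (Q \<epsilon>) - ln (R \<epsilon>))) (a * (ln a - ln a'))
      (a * (b / a - b' / a') + b * (ln a - ln a'))"
    by (intro first_order_mult first_order_diff first_order_ln Q R a)
  have ev: "\<forall>\<^sub>F \<epsilon> in at_right 0. Q \<epsilon> * (ln (Q \<epsilon>) - ln (R \<epsilon>)) = entropy_term (Q \<epsilon>) (R \<epsilon>)"
    using eventually_pos[OF first_order_zero_order[OF Q] a(1)]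
      eventually_pos[OF first_order_zero_order[OF R] a(2)]
    by eventually_elim (simp add: entropy_term_def ln_div)
  have "a * (b / a - b' / a') + b * (ln a - ln a') = b * ln (a / a') + (b * a' - b' * a) / a'"
    using a by (simp add: ln_div field_simps)
  moreover have "a * (ln a - ln a') = entropy_term a a'"
    using a by (simp add: entropy_term_def ln_div)
  ultimately show ?thesis
    using main unfolding first_order_def
    by (elim bigo_eventually_eq[rotated]) (use ev in eventually_elim, simp)
qed

text \<open>The source of the logarithmic term. With \<open>Q = \<epsilon> q\<close> the logarithm
  splits into \<open>ln \<epsilon>\<close> and a bounded part; the error of order
  \<open>\<epsilon>\<close> in \<open>q\<close>, multiplied by
  \<open>\<epsilon> * ln \<epsilon>\<close>, gives the error term.\<close>

lemma entropy_term_expansion_lead: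
  assumes Q: "first_order Q 0 b" and R: "first_order R a' b'" and pos: "b > 0" "a' > 0"
  shows "(\<lambda>\<epsilon>. entropy_term (Q \<epsilon>) (R \<epsilon>) - (b * (\<epsilon> * ln \<epsilon>) + b * ln (b / a') * \<epsilon>))
           \<in> O[at_right 0](\<lambda>\<epsilon>. \<epsilon>\<^sup>2 * ln \<epsilon>)"
proof -
  let ?q = "\<lambda>\<epsilon>. Q \<epsilon> / \<epsilon>"
  let ?L = "\<lambda>\<epsilon>. ln (?q \<epsilon>) - ln (R \<epsilon>)"
  note q = first_order_divide_eps[OF Q] and r = first_order_zero_order[OF R]
  have "(\<lambda>\<epsilon>. (ln (?q \<epsilon>) - ln b) - (ln (R \<epsilon>) - ln a')) \<in> O[at_right 0](\<lambda>\<epsilon>. \<epsilon>)"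
    by (intro sum_in_bigo zero_order_ln q r pos)
  then have L: "(\<lambda>\<epsilon>. ?L \<epsilon> - ln (b / a')) \<in> O[at_right 0](\<lambda>\<epsilon>. \<epsilon>)"
    using pos by (simp add: ln_div algebra_simps)
  have "(\<lambda>\<epsilon>. (?q \<epsilon> - b) * (\<epsilon> * ln \<epsilon>)) \<in> O[at_right 0](\<lambda>\<epsilon>. \<epsilon> * (\<epsilon> * ln \<epsilon>))"
    by (rule landau_o.big.mult[OF q landau_o.big_refl])
  moreover have "(\<lambda>\<epsilon>. \<epsilon> * ((?q \<epsilon> - b) * ?L \<epsilon>)) \<in> O[at_right 0](\<lambda>\<epsilon>. \<epsilon> * (\<epsilon> * 1))"
    by (intro landau_o.big.mult q landau_o.big_refl zero_order_bigo_one[OF L])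
  then have "(\<lambda>\<epsilon>. \<epsilon> * ((?q \<epsilon> - b) * ?L \<epsilon>)) \<in> O[at_right 0](\<lambda>\<epsilon>. \<epsilon>\<^sup>2 * ln \<epsilon>)"
    using landau_o.big_trans[OF _ eps2_bigo_eps2_ln] by (simp add: power2_eq_square)
  moreover have "(\<lambda>\<epsilon>. \<epsilon> * (b * (?L \<epsilon> - ln (b / a')))) \<in> O[at_right 0](\<lambda>\<epsilon>. \<epsilon> * \<epsilon>)"
    using pos by (intro landau_o.big.mult landau_o.big_refl) (simp add: L)
  then have "(\<lambda>\<epsilon>. \<epsilon> * (b * (?L \<epsilon> - ln (b / a')))) \<in> O[at_right 0](\<lambda>\<epsilon>. \<epsilon>\<^sup>2 * ln \<epsilon>)"
    using landau_o.big_trans[OF _ eps2_bigo_eps2_ln] by (simp add: power2_eq_square)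
  ultimately have main: "(\<lambda>\<epsilon>. (?q \<epsilon> - b) * (\<epsilon> * ln \<epsilon>) + \<epsilon> * ((?q \<epsilon> - b) * ?L \<epsilon>)
      + \<epsilon> * (b * (?L \<epsilon> - ln (b / a')))) \<in> O[at_right 0](\<lambda>\<epsilon>. \<epsilon>\<^sup>2 * ln \<epsilon>)"
    by (intro sum_in_bigo) (simp_all add: power2_eq_square mult.assoc)
  have "\<forall>\<^sub>F \<epsilon>::real in at_right 0. \<epsilon> > 0" by (auto simp: eventually_at intro!: exI[of _ 1])
  then have "\<forall>\<^sub>F \<epsilon> in at_right 0. entropy_term (Q \<epsilon>) (R \<epsilon>) - (b * (\<epsilon> * ln \<epsilon>) + b * ln (b / a') * \<epsilon>)
     = (?q \<epsilon> - b) * (\<epsilon> * ln \<epsilon>) + \<epsilon> * ((?q \<epsilon> - b) * ?L \<epsilon>) + \<epsilon> * (b * (?L \<epsilon> - ln (b / a')))"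
    using eventually_pos[OF q pos(1)] eventually_pos[OF r pos(2)]
  proof eventually_elim
    case (elim \<epsilon>)
    then have "Q \<epsilon> > 0" by (simp add: zero_less_divide_iff)
    then have "ln (Q \<epsilon> / R \<epsilon>) = ln \<epsilon> + ?L \<epsilon>"
      using elim by (simp add: ln_div)
    moreover have "Q \<epsilon> = \<epsilon> * ?q \<epsilon>" using elim by simp
    ultimately have eq: "entropy_term (Q \<epsilon>) (R \<epsilon>) = (\<epsilon> * ?q \<epsilon>) * (ln \<epsilon> + ?L \<epsilon>)"
      unfolding entropy_term_def by presburger
    have "(e * q) * (s + l) - (b * (e * s) + b * k * e) = (q - b) * (e * s) + e * ((q - b) * l) + e * (b * (l - k))"
      for e q s l k :: real by (simp add: algebra_simps)
    then show ?case unfolding eq .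
  qed
  then show ?thesis using main by (rule bigo_eventually_eq)
qed

text \<open>Here the factors \<open>\<epsilon>\<close> cancel inside the logarithm, so no
  \<open>\<epsilon> * ln \<epsilon>\<close> appears.\<close>

lemma entropy_term_expansion_both:
  assumes Q: "first_order Q 0 b" and R: "first_order R 0 b'" and pos: "b > 0" "b' > 0"
  shows "(\<lambda>\<epsilon>. entropy_term (Q \<epsilon>) (R \<epsilon>) - b * ln (b / b') * \<epsilon>) \<in> O[at_right 0](\<lambda>\<epsilon>. \<epsilon>\<^sup>2)"
proof -
  let ?q = "\<lambda>\<epsilon>. Q \<epsilon> / \<epsilon>" and ?r = "\<lambda>\<epsilon>. R \<epsilon> / \<epsilon>"
  let ?L = "\<lambda>\<epsilon>. ln (?q \<epsilon>) - ln (?r \<epsilon>)"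
  note q = first_order_divide_eps[OF Q] and r = first_order_divide_eps[OF R]
  have "(\<lambda>\<epsilon>. (ln (?q \<epsilon>) - ln b) - (ln (?r \<epsilon>) - ln b')) \<in> O[at_right 0](\<lambda>\<epsilon>. \<epsilon>)"
    by (intro sum_in_bigo zero_order_ln q r pos)
  then have L: "(\<lambda>\<epsilon>. ?L \<epsilon> - ln (b / b')) \<in> O[at_right 0](\<lambda>\<epsilon>. \<epsilon>)"
    using pos by (simp add: ln_div algebra_simps)
  have "(\<lambda>\<epsilon>. \<epsilon> * ((?q \<epsilon> - b) * ?L \<epsilon>)) \<in> O[at_right 0](\<lambda>\<epsilon>. \<epsilon> * (\<epsilon> * 1))"
    by (intro landau_o.big.mult q landau_o.big_refl zero_order_bigo_one[OF L])
  moreover have "(\<lambda>\<epsilon>. \<epsilon> * (b * (?L \<epsilon> - ln (b / b')))) \<in> O[at_right 0](\<lambda>\<epsilon>. \<epsilon> * \<epsilon>)"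
    using pos by (intro landau_o.big.mult landau_o.big_refl) (simp add: L)
  ultimately have main: "(\<lambda>\<epsilon>. \<epsilon> * ((?q \<epsilon> - b) * ?L \<epsilon>)
      + \<epsilon> * (b * (?L \<epsilon> - ln (b / b')))) \<in> O[at_right 0](\<lambda>\<epsilon>. \<epsilon>\<^sup>2)"
    by (intro sum_in_bigo) (simp_all add: power2_eq_square mult.assoc)
  have "\<forall>\<^sub>F \<epsilon>::real in at_right 0. \<epsilon> > 0" by (auto simp: eventually_at intro!: exI[of _ 1])
  then have "\<forall>\<^sub>F \<epsilon> in at_right 0. entropy_term (Q \<epsilon>) (R \<epsilon>) - b * ln (b / b') * \<epsilon>
     = \<epsilon> * ((?q \<epsilon> - b) * ?L \<epsilon>) + \<epsilon> * (b * (?L \<epsilon> - ln (b / b')))"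
    using eventually_pos[OF q pos(1)] eventually_pos[OF r pos(2)]
  proof eventually_elim
    case (elim \<epsilon>)
    then have "Q \<epsilon> > 0" "R \<epsilon> > 0" by (simp_all add: zero_less_divide_iff)
    then have "ln (Q \<epsilon> / R \<epsilon>) = ?L \<epsilon>"
      using elim by (simp add: ln_div)
    moreover have "Q \<epsilon> = \<epsilon> * ?q \<epsilon>" using elim by simp
    ultimately have eq: "entropy_term (Q \<epsilon>) (R \<epsilon>) = (\<epsilon> * ?q \<epsilon>) * ?L \<epsilon>"
      unfolding entropy_term_def by presburger
    have "(e * q) * l - b * k * e = e * ((q - b) * l) + e * (b * (l - k))"
      for e q l k :: real by (simp add: algebra_simps)
    then show ?case unfolding eq .
  qed
  then show ?thesis using main by (rule bigo_eventually_eq)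
qed

text \<open>\<open>Q\<close> may vanish to any higher order. Because \<open>R \<le> 1\<close>, the
  monomial bound on \<open>Q\<close> also bounds \<open>Q / R\<close> from below, so the logarithm
  is still of order \<open>ln \<epsilon>\<close> while \<open>Q\<close> is of order
  \<open>\<epsilon>\<^sup>2\<close>.\<close>

lemma entropy_term_negligible:
  assumes Q: "first_order Q 0 0" and c: "c > 0"
    and bounds: "\<And>\<epsilon>. 0 < \<epsilon> \<Longrightarrow> \<epsilon> \<le> 1 / 2 \<Longrightarrow> c * \<epsilon> ^ l \<le> Q \<epsilon> \<and> Q \<epsilon> \<le> R \<epsilon> \<and> R \<epsilon> \<le> 1"
  shows "(\<lambda>\<epsilon>. entropy_term (Q \<epsilon>) (R \<epsilon>)) \<in> O[at_right 0](\<lambda>\<epsilon>. \<epsilon>\<^sup>2 * ln \<epsilon>)"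
proof -
  have "(\<lambda>\<epsilon>. ln (Q \<epsilon> / R \<epsilon>)) \<in> O[at_right 0](\<lambda>\<epsilon>. ln c + real l * ln \<epsilon>)"
  proof (rule bigoI[of _ 1])
    have "norm (ln (Q \<epsilon> / R \<epsilon>)) \<le> 1 * norm (ln c + real l * ln \<epsilon>)"
      if e: "0 < \<epsilon>" "\<epsilon> < 1 / 2" for \<epsilon>
    proof -
      note b = bounds[of \<epsilon>]
      have pos: "0 < c * \<epsilon> ^ l" using c e by simp
      have Qpos: "0 < Q \<epsilon>" "0 < R \<epsilon>" using b e pos by auto
      have "c * \<epsilon> ^ l * R \<epsilon> \<le> Q \<epsilon> * 1" using b e pos Qpos by (intro mult_mono) auto
      then have "c * \<epsilon> ^ l \<le> Q \<epsilon> / R \<epsilon>" using Qpos by (simp add: field_simps)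
      then have "ln (c * \<epsilon> ^ l) \<le> ln (Q \<epsilon> / R \<epsilon>)" using pos Qpos by simp
      moreover have "ln (Q \<epsilon> / R \<epsilon>) \<le> 0" using b e Qpos by simp
      moreover have "ln (c * \<epsilon> ^ l) = ln c + real l * ln \<epsilon>"
        using c e by (simp add: ln_mult ln_realpow)
      ultimately show ?thesis by simp
    qed
    then show "\<forall>\<^sub>F \<epsilon> in at_right 0. norm (ln (Q \<epsilon> / R \<epsilon>)) \<le> 1 * norm (ln c + real l * ln \<epsilon>)"
      by (auto simp: eventually_at intro!: exI[of _ "1 / 2"])
  qed
  also have "(\<lambda>\<epsilon>. ln c + real l * ln \<epsilon>) \<in> O[at_right 0](\<lambda>\<epsilon>. ln \<epsilon>)"
    using landau_o.big.mult[OF landau_o.big_refl[of "\<lambda>_. ln c"] one_bigo_ln]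
    by (intro sum_in_bigo) (auto intro: landau_o.big_trans[OF _ one_bigo_ln])
  finally have "(\<lambda>\<epsilon>. ln (Q \<epsilon> / R \<epsilon>)) \<in> O[at_right 0](\<lambda>\<epsilon>. ln \<epsilon>)" .
  then have "(\<lambda>\<epsilon>. Q \<epsilon> * ln (Q \<epsilon> / R \<epsilon>)) \<in> O[at_right 0](\<lambda>\<epsilon>. \<epsilon>\<^sup>2 * ln \<epsilon>)"
    using Q by (intro landau_o.big.mult) (simp_all add: first_order_def)
  then show ?thesis by (simp add: entropy_term_def)
qed

section \<open>The channel on words\<close>

text \<open>The probability of output \<open>z\<close> given input \<open>u\<close> of the same
  length. The value on words of different lengths is a default that \<open>noisy\<close> never
  meets.\<close>

fun bsc_kernel :: "real \<Rightarrow> bool list \<Rightarrow> bool list \<Rightarrow> real" where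
  "bsc_kernel \<epsilon> (a # u) (b # z) = (if a = b then 1 - \<epsilon> else \<epsilon>) * bsc_kernel \<epsilon> u z"
| "bsc_kernel \<epsilon> _ _ = 1"

text \<open>An arbitrary weight \<open>\<phi>\<close> is allowed so that a prefix can be absorbed
  into it: this gives the recursion \<open>noisy_Cons\<close> and, later, the directly seen letters
  of \<open>obs\<close>.\<close>

definition noisy :: "(bool list \<Rightarrow> real) \<Rightarrow> real \<Rightarrow> bool list \<Rightarrow> real" where
  "noisy \<phi> \<epsilon> z = (\<Sum>u\<in>words (length z). \<phi> u * bsc_kernel \<epsilon> u z)"

lemma bsc_kernel_append:
  "length u = length z \<Longrightarrow> bsc_kernel \<epsilon> (u @ u') (z @ z') = bsc_kernel \<epsilon> u z * bsc_kernel \<epsilon> u' z'"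
  by (induction u z rule: list_induct2) auto

lemma bsc_kernel_nonneg: "0 \<le> \<epsilon> \<Longrightarrow> \<epsilon> \<le> 1 \<Longrightarrow> 0 \<le> bsc_kernel \<epsilon> u z"
  by (induction \<epsilon> u z rule: bsc_kernel.induct) auto

lemma bsc_kernel_lower:
  assumes "length u = length z" "0 \<le> \<epsilon>" "\<epsilon> \<le> 1 / 2"
  shows "\<epsilon> ^ length z \<le> bsc_kernel \<epsilon> u z"
  using assms by (induction u z rule: list_induct2) (auto intro!: mult_mono)

lemma sum_bsc_kernel: "(\<Sum>z\<in>words (length u). bsc_kernel \<epsilon> u z) = 1"
proof (induction u)
  case (Cons a u)
  then show ?case by (cases a) (simp_all add: sum_words_Suc_Cons UNIV_bool flip: sum_distrib_left)
qed simp

lemma noisy_Nil [simp]: "noisy \<phi> \<epsilon> [] = \<phi> []"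
  by (simp add: noisy_def)

lemma noisy_Cons:
  "noisy \<phi> \<epsilon> (b # z) = (1 - \<epsilon>) * noisy (\<lambda>u. \<phi> (b # u)) \<epsilon> z + \<epsilon> * noisy (\<lambda>u. \<phi> ((\<not> b) # u)) \<epsilon> z"
  by (cases b)
     (simp_all add: noisy_def sum_words_Suc_Cons UNIV_bool sum_distrib_left mult.assoc mult.left_commute)

lemma noisy_noiseless: "noisy \<phi> 0 z = \<phi> z"
  by (induction z arbitrary: \<phi>) (simp_all add: noisy_Cons)

lemma noisy_add: "noisy (\<lambda>u. \<phi> u + \<psi> u) \<epsilon> z = noisy \<phi> \<epsilon> z + noisy \<psi> \<epsilon> z"
  by (simp add: noisy_def sum.distrib ring_distribs)

lemma noisy_snoc: "(\<Sum>v\<in>UNIV. noisy \<phi> \<epsilon> (z @ [v])) = noisy (\<lambda>u. \<Sum>v\<in>UNIV. \<phi> (u @ [v])) \<epsilon> z"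
proof (induction z arbitrary: \<phi>)
  case Nil
  show ?case by (simp add: noisy_Cons UNIV_bool algebra_simps)
next
  case (Cons b z)
  show ?case by (simp add: noisy_Cons sum.distrib Cons flip: sum_distrib_left)
qed

lemma noisy_nonneg: "(\<And>u. 0 \<le> \<phi> u) \<Longrightarrow> 0 \<le> \<epsilon> \<Longrightarrow> \<epsilon> \<le> 1 \<Longrightarrow> 0 \<le> noisy \<phi> \<epsilon> z"
  unfolding noisy_def by (intro sum_nonneg mult_nonneg_nonneg bsc_kernel_nonneg) auto

text \<open>A single source word of positive weight already forces a monomial lower bound, as
  \<open>entropy_term_negligible\<close> requires.\<close>

lemma noisy_lower:
  assumes "\<And>u. 0 \<le> \<phi> u" "length u = length z" "0 \<le> \<epsilon>" "\<epsilon> \<le> 1 / 2"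
  shows "\<phi> u * \<epsilon> ^ length z \<le> noisy \<phi> \<epsilon> z"
proof -
  have "\<phi> u * \<epsilon> ^ length z \<le> \<phi> u * bsc_kernel \<epsilon> u z"
    using assms by (intro mult_left_mono bsc_kernel_lower) auto
  also have "\<dots> \<le> noisy \<phi> \<epsilon> z"
    unfolding noisy_def using assms
    by (intro member_le_sum[of u] mult_nonneg_nonneg bsc_kernel_nonneg finite_words) auto
  finally show ?thesis .
qed

abbreviation flip :: "bool list \<Rightarrow> nat \<Rightarrow> bool list" where
  "flip u j \<equiv> u[j := \<not> u ! j]"

text \<open>To first order at most one letter is corrupted: each single flip costs a factor
  \<open>\<epsilon>\<close>, and no flip at all has probability
  \<open>(1 - \<epsilon>) ^ length z\<close>.\<close>

lemma noisy_first_order: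
  "first_order (\<lambda>\<epsilon>. noisy \<phi> \<epsilon> z) (\<phi> z) ((\<Sum>j<length z. \<phi> (flip z j)) - real (length z) * \<phi> z)"
proof (induction z arbitrary: \<phi>)
  case Nil
  show ?case using first_order_const[of "\<phi> []"] by simp
next
  case (Cons b z)
  have *: "first_order (\<lambda>\<epsilon>. 1 - \<epsilon>) 1 (-1)"
    using first_order_diff[OF first_order_const first_order_id, of 1] by simp
  show ?case
    using first_order_add[OF first_order_mult[OF * Cons[of "\<lambda>u. \<phi> (b # u)"]]
        first_order_mult[OF first_order_id Cons[of "\<lambda>u. \<phi> ((\<not> b) # u)"]]]
    by (simp add: noisy_Cons sum.lessThan_Suc_shift algebra_simps del: sum.lessThan_Suc)
qed

section \<open>Markov word distributions and their noisy observations\<close>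

text \<open>Conditional independence of past and future given \<open>m\<close> letters,
  cross-multiplied so that it makes sense for states of probability zero.\<close>

locale markov_words = stationary_words p for p :: "bool list \<Rightarrow> real" +
  fixes m :: nat
  assumes markov: "length x = m \<Longrightarrow> p (u @ x @ s) * p x = p (u @ x) * p (x @ s)"
begin

text \<open>\<open>obs k \<epsilon>\<close> is \<open>p\<^sub>X\<^sub>Z\<close>: the first \<open>k\<close> letters are seen directly and the others through the channel.\<close>

definition obs :: "nat \<Rightarrow> real \<Rightarrow> bool list \<Rightarrow> real" where
  "obs k \<epsilon> z = noisy (\<lambda>u. p (take k z @ u)) \<epsilon> (drop k z)"

lemma obs_append: "length x = k \<Longrightarrow> obs k \<epsilon> (x @ t) = noisy (\<lambda>u. p (x @ u)) \<epsilon> t"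
  by (simp add: obs_def)

lemma obs_0: "obs 0 \<epsilon> z = noisy p \<epsilon> z"
  by (simp add: obs_def)

lemma obs_noiseless: "obs k 0 z = p z"
  by (simp add: obs_def noisy_noiseless)

lemma obs_nonneg: "0 \<le> \<epsilon> \<Longrightarrow> \<epsilon> \<le> 1 \<Longrightarrow> 0 \<le> obs k \<epsilon> z"
  by (simp add: obs_def noisy_nonneg nonneg)

lemma obs_snoc:
  assumes "k \<le> length z"
  shows "(\<Sum>v\<in>UNIV. obs k \<epsilon> (z @ [v])) = obs k \<epsilon> z"
proof -
  have "(\<Sum>v\<in>UNIV. obs k \<epsilon> (z @ [v])) = (\<Sum>v\<in>UNIV. noisy (\<lambda>u. p (take k z @ u)) \<epsilon> (drop k z @ [v]))"
    using assms by (simp add: obs_def)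
  also have "\<dots> = obs k \<epsilon> z"
    using sum_snoc[of "take k z @ _"] by (simp add: noisy_snoc obs_def)
  finally show ?thesis .
qed

lemma obs_snoc_le:
  assumes "k \<le> length z" "0 \<le> \<epsilon>" "\<epsilon> \<le> 1"
  shows "obs k \<epsilon> (z @ [v]) \<le> obs k \<epsilon> z"
proof -
  have "obs k \<epsilon> (z @ [v]) \<le> (\<Sum>v\<in>UNIV. obs k \<epsilon> (z @ [v]))"
    by (rule member_le_sum) (use assms in \<open>auto intro: obs_nonneg\<close>)
  then show ?thesis by (simp add: obs_snoc assms)
qed

lemma obs_le_1:
  assumes "0 \<le> \<epsilon>" "\<epsilon> \<le> 1"
  shows "obs k \<epsilon> z \<le> 1"
proof -
  have "noisy (\<lambda>u. p (x @ u)) \<epsilon> t \<le> 1" if "length x = k" for x t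
  proof (induction t rule: rev_induct)
    case Nil
    show ?case using append_le_left[of "[]" x] by (simp add: empty_word)
  next
    case (snoc v t)
    then show ?case using obs_snoc_le[of k "x @ t" \<epsilon> v] that assms obs_append[OF that, of \<epsilon> "t @ [v]"] by (simp add: obs_append[OF that])
  qed
  then show ?thesis
  proof (cases "k \<le> length z")
    case False
    then show ?thesis using append_le_left[of "[]" z] by (simp add: obs_def empty_word)
  qed (simp add: obs_def)
qed

lemma stationary_words_obs:
  assumes "0 \<le> \<epsilon>" "\<epsilon> \<le> 1"
  shows "stationary_words (obs 0 \<epsilon>)"
proof
  show "0 \<le> obs 0 \<epsilon> u" for u by (rule obs_nonneg[OF assms])
  show "obs 0 \<epsilon> [] = 1" by (simp add: obs_0 empty_word)
  show "(\<Sum>v\<in>UNIV. obs 0 \<epsilon> (u @ [v])) = obs 0 \<epsilon> u" for u by (simp add: obs_snoc)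
  have p: "p (False # u) + p (True # u) = p u" for u using sum_Cons[of u] by (simp add: UNIV_bool)
  show "(\<Sum>a\<in>UNIV. obs 0 \<epsilon> (a # u)) = obs 0 \<epsilon> u" for u
  proof -
    have "(\<Sum>a\<in>UNIV. obs 0 \<epsilon> (a # u))
        = noisy (\<lambda>u. p (False # u)) \<epsilon> u + noisy (\<lambda>u. p (True # u)) \<epsilon> u"
      by (simp add: obs_0 noisy_Cons UNIV_bool algebra_simps)
    also have "\<dots> = obs 0 \<epsilon> u" by (simp add: obs_0 p flip: noisy_add)
    finally show ?thesis .
  qed
qed

text \<open>The conditional probability of seeing the output \<open>y @ z\<close> given that the
  source shows \<open>x\<close> underneath \<open>z\<close>; it is 0 if
  \<open>p x = 0\<close>.\<close>

definition past_weight :: "real \<Rightarrow> bool list \<Rightarrow> bool list \<Rightarrow> bool list \<Rightarrow> real" where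
  "past_weight \<epsilon> y z x =
     (\<Sum>u\<in>words (length y). p (u @ x) / p x * bsc_kernel \<epsilon> u y) * bsc_kernel \<epsilon> x z"

lemma past_weight_nonneg: "0 \<le> \<epsilon> \<Longrightarrow> \<epsilon> \<le> 1 \<Longrightarrow> 0 \<le> past_weight \<epsilon> y z x"
  unfolding past_weight_def
  by (intro mult_nonneg_nonneg sum_nonneg bsc_kernel_nonneg divide_nonneg_nonneg nonneg)

lemma sum_past_weight:
  assumes "p x \<noteq> 0" "length x = m"
  shows "(\<Sum>y\<in>words d. \<Sum>z\<in>words m. past_weight \<epsilon> y z x) = 1"
proof -
  have "(\<Sum>y\<in>words d. \<Sum>z\<in>words m. past_weight \<epsilon> y z x)
      = (\<Sum>y\<in>words d. \<Sum>u\<in>words d. p (u @ x) / p x * bsc_kernel \<epsilon> u y)"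
  proof (rule sum.cong[OF refl])
    fix y assume "y \<in> words d"
    then show "(\<Sum>z\<in>words m. past_weight \<epsilon> y z x)
        = (\<Sum>u\<in>words d. p (u @ x) / p x * bsc_kernel \<epsilon> u y)"
      using sum_bsc_kernel[of \<epsilon> x] assms by (simp add: past_weight_def flip: sum_distrib_left)
  qed
  also have "\<dots> = (\<Sum>u\<in>words d. \<Sum>y\<in>words d. p (u @ x) / p x * bsc_kernel \<epsilon> u y)"
    by (rule sum.swap)
  also have "\<dots> = (\<Sum>u\<in>words d. p (u @ x) / p x)"
  proof (intro sum.cong refl)
    fix u assume "u \<in> words d"
    then show "(\<Sum>y\<in>words d. p (u @ x) / p x * bsc_kernel \<epsilon> u y) = p (u @ x) / p x"
      using sum_bsc_kernel[of \<epsilon> u] by (simp del: times_divide_eq_left flip: sum_distrib_left)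
  qed
  also have "\<dots> = 1" using assms sum_append_left[of x d] by (simp flip: sum_divide_distrib)
  finally show ?thesis .
qed

text \<open>Sum over the hidden letters \<open>x\<close> underneath \<open>z\<close>: given these,
  the outputs \<open>y @ z\<close> are independent of \<open>t\<close> by the Markov property and
  the memoryless channel.\<close>

lemma obs_0_decompose:
  assumes z: "length z = m"
  shows "obs 0 \<epsilon> (y @ z @ t) = (\<Sum>x\<in>words m. past_weight \<epsilon> y z x * obs m \<epsilon> (x @ t))"
proof -
  have p: "p (u @ x @ s) = p (u @ x) / p x * p (x @ s)" if "length x = m" for u x s
  proof (cases "p x = 0")
    case True
    then have "p (x @ s) = 0" using append_le_left[of x s] nonneg[of "x @ s"] by simp
    then have "p (u @ x @ s) = 0" using append_le_right[of u "x @ s"] nonneg[of "u @ x @ s"] by simp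
    then show ?thesis using True by simp
  next
    case False
    then show ?thesis using markov[OF that, of u s] by (simp add: field_simps)
  qed
  have "obs 0 \<epsilon> (y @ z @ t) = (\<Sum>u\<in>words (length y). \<Sum>x\<in>words m. \<Sum>s\<in>words (length t).
          p (u @ x @ s) * bsc_kernel \<epsilon> (u @ x @ s) (y @ z @ t))"
    by (simp add: obs_0 noisy_def sum_words_add z)
  also have "\<dots> = (\<Sum>u\<in>words (length y). \<Sum>x\<in>words m. \<Sum>s\<in>words (length t).
        (p (u @ x) / p x * bsc_kernel \<epsilon> u y) * bsc_kernel \<epsilon> x z * (p (x @ s) * bsc_kernel \<epsilon> s t))"
    by (intro sum.cong refl) (simp add: bsc_kernel_append z p)
  also have "\<dots> = (\<Sum>x\<in>words m. \<Sum>u\<in>words (length y). \<Sum>s\<in>words (length t).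
        (p (u @ x) / p x * bsc_kernel \<epsilon> u y) * bsc_kernel \<epsilon> x z * (p (x @ s) * bsc_kernel \<epsilon> s t))"
    by (rule sum.swap)
  also have "\<dots> = (\<Sum>x\<in>words m. past_weight \<epsilon> y z x * obs m \<epsilon> (x @ t))"
    by (intro sum.cong refl,
        simp add: past_weight_def obs_append noisy_def sum_distrib_left sum_distrib_right, rule sum.swap)
  finally show ?thesis .
qed

text \<open>Revealing \<open>m\<close> letters of \<open>X\<close> makes the observations before them irrelevant, and lowers the
  entropy of the next letter.\<close>

lemma cond_ent_obs_le:
  assumes e: "0 \<le> \<epsilon>" "\<epsilon> \<le> 1" and mn: "m \<le> n"
  shows "cond_ent (obs m \<epsilon>) n \<le> cond_ent (obs 0 \<epsilon>) (d + n)"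
proof -
  define b where "b = n - m"
  have n: "n = m + b" using mn by (simp add: b_def)
  let ?T = "\<lambda>x t v. entropy_term (obs m \<epsilon> (x @ t @ [v])) (obs m \<epsilon> (x @ t))"
  have "(\<Sum>w\<in>words (d + n). \<Sum>v\<in>UNIV. entropy_term (obs 0 \<epsilon> (w @ [v])) (obs 0 \<epsilon> w))
    = (\<Sum>y\<in>words d. \<Sum>z\<in>words m. \<Sum>t\<in>words b. \<Sum>v\<in>UNIV.
        entropy_term (obs 0 \<epsilon> (y @ z @ t @ [v])) (obs 0 \<epsilon> (y @ z @ t)))"
    by (simp add: n sum_words_add)
  also have "\<dots> \<le> (\<Sum>y\<in>words d. \<Sum>z\<in>words m. \<Sum>t\<in>words b. \<Sum>v\<in>UNIV. \<Sum>x\<in>words m.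
        past_weight \<epsilon> y z x * ?T x t v)"
  proof (intro sum_mono)
    fix y z t v assume "z \<in> words m"
    then have z: "length z = m" by simp
    \<comment> \<open>Log-sum over the hidden state \<open>x\<close>. The weight does not depend on
      \<open>t\<close> or \<open>v\<close>, so it cancels inside the logarithm, and its sum over
      \<open>y\<close> and \<open>z\<close> is 1.\<close>
    have "entropy_term (obs 0 \<epsilon> (y @ z @ t @ [v])) (obs 0 \<epsilon> (y @ z @ t))
      \<le> (\<Sum>x\<in>words m. entropy_term (past_weight \<epsilon> y z x * obs m \<epsilon> (x @ t @ [v]))
                                   (past_weight \<epsilon> y z x * obs m \<epsilon> (x @ t)))"
      unfolding obs_0_decompose[OF z]
    proof (intro log_sum_inequality finite_words mult_nonneg_nonneg past_weight_nonneg obs_nonneg e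
        mult_left_mono)
      fix x assume "x \<in> words m"
      then show "obs m \<epsilon> (x @ t @ [v]) \<le> obs m \<epsilon> (x @ t)"
        using obs_snoc_le[of m "x @ t" \<epsilon> v] e by simp
    qed
    also have "\<dots> = (\<Sum>x\<in>words m. past_weight \<epsilon> y z x * ?T x t v)"
    proof (intro sum.cong refl)
      fix x
      show "entropy_term (past_weight \<epsilon> y z x * obs m \<epsilon> (x @ t @ [v])) (past_weight \<epsilon> y z x * obs m \<epsilon> (x @ t))
          = past_weight \<epsilon> y z x * ?T x t v"
        by (cases "past_weight \<epsilon> y z x = 0") (auto intro: entropy_term_scale)
    qed
    finally show "entropy_term (obs 0 \<epsilon> (y @ z @ t @ [v])) (obs 0 \<epsilon> (y @ z @ t)) \<le> \<dots>" .
  qed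
  also have "\<dots> = (\<Sum>x\<in>words m. \<Sum>t\<in>words b. \<Sum>v\<in>UNIV.
      (\<Sum>y\<in>words d. \<Sum>z\<in>words m. past_weight \<epsilon> y z x) * ?T x t v)"
  proof -
    let ?g = "\<lambda>y z t v x. past_weight \<epsilon> y z x * ?T x t v"
    have "(\<Sum>y\<in>words d. \<Sum>z\<in>words m. \<Sum>t\<in>words b. \<Sum>v\<in>UNIV. \<Sum>x\<in>words m. ?g y z t v x)
      = (\<Sum>(y, z, t, v, x) \<in> words d \<times> words m \<times> words b \<times> UNIV \<times> words m. ?g y z t v x)"
      by (simp only: sum.cartesian_product split_def fst_conv snd_conv)
    also have "\<dots> = (\<Sum>(x, t, v, y, z) \<in> words m \<times> words b \<times> UNIV \<times> words d \<times> words m. ?g y z t v x)"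
      by (rule sum.reindex_bij_witness[of _ "\<lambda>(x, t, v, y, z). (y, z, t, v, x)"
            "\<lambda>(y, z, t, v, x). (x, t, v, y, z)"]) auto
    also have "\<dots> = (\<Sum>x\<in>words m. \<Sum>t\<in>words b. \<Sum>v\<in>UNIV. \<Sum>y\<in>words d. \<Sum>z\<in>words m. ?g y z t v x)"
      by (simp only: sum.cartesian_product split_def fst_conv snd_conv)
    finally show ?thesis by (simp only: sum_distrib_right)
  qed
  also have "\<dots> = (\<Sum>x\<in>words m. \<Sum>t\<in>words b. \<Sum>v\<in>UNIV. ?T x t v)"
  proof (intro sum.cong refl)
    fix x t v assume x: "x \<in> words m"
    show "(\<Sum>y\<in>words d. \<Sum>z\<in>words m. past_weight \<epsilon> y z x) * ?T x t v = ?T x t v"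
    \<comment> \<open>For an impossible state the weights do not sum to 1, but then the entropy term
      itself is zero.\<close>
    proof (cases "p x = 0")
      case True
      then have "p (x @ u) = 0" for u using append_le_left[of x u] nonneg[of "x @ u"] by simp
      then have "obs m \<epsilon> (x @ s) = 0" for s using x by (simp add: obs_append noisy_def)
      then show ?thesis by simp
    next
      case False
      then show ?thesis using x sum_past_weight by simp
    qed
  qed
  also have "\<dots> = (\<Sum>w\<in>words n. \<Sum>v\<in>UNIV. entropy_term (obs m \<epsilon> (w @ [v])) (obs m \<epsilon> w))"
    by (simp add: n sum_words_add)
  finally show ?thesis by (simp add: cond_ent_def)
qed

text \<open>The lower bound comes from \<open>cond_ent_obs_le\<close>, which holds for every number
  \<open>d\<close> of additional letters and so survives the limit; the upper bound is
  monotonicity.\<close>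

lemma rate_obs_bounds:
  assumes e: "0 \<le> \<epsilon>" "\<epsilon> \<le> 1" and mn: "m \<le> n"
  shows "cond_ent (obs m \<epsilon>) n \<le> stationary_words.rate (obs 0 \<epsilon>)"
    and "stationary_words.rate (obs 0 \<epsilon>) \<le> cond_ent (obs 0 \<epsilon>) n"
proof -
  interpret Z: stationary_words "obs 0 \<epsilon>" by (rule stationary_words_obs[OF e])
  show "Z.rate \<le> cond_ent (obs 0 \<epsilon>) n" by (rule Z.rate_le_cond_ent)
  show "cond_ent (obs m \<epsilon>) n \<le> Z.rate"
  proof (rule LIMSEQ_le_const[OF Z.cond_ent_tendsto_rate], intro exI allI impI)
    fix N assume "n \<le> N"
    then show "cond_ent (obs m \<epsilon>) n \<le> cond_ent (obs 0 \<epsilon>) N"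
      using cond_ent_obs_le[OF e mn, of "N - n"] by simp
  qed
qed

text \<open>Without noise, seeing the source and seeing the output are the same, so the two bounds
  of \<open>rate_obs_bounds\<close> coincide.\<close>

lemma rate_eq_cond_ent: "m \<le> n \<Longrightarrow> rate = cond_ent p n"
  using rate_obs_bounds[of 0 n] obs_noiseless by (simp add: fun_eq_iff ext[OF obs_noiseless])

section \<open>First-order expansion of the conditional entropies\<close>

definition hc :: "nat \<Rightarrow> bool list \<Rightarrow> real" where
  "hc k u = (\<Sum>j\<in>{k..<length u}. p (flip u j)) - real (length u - k) * p u"

lemma obs_first_order:
  assumes "k \<le> length z"
  shows "first_order (\<lambda>\<epsilon>. obs k \<epsilon> z) (p z) (hc k z)"
proof -
  have flip: "flip z (j + k) = take k z @ flip (drop k z) j" if "j < length z - k" for j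
  proof -
    have "flip (take k z @ drop k z) (j + k) = take k z @ flip (drop k z) j"
      using assms that by (simp add: list_update_append nth_append del: append_take_drop_id)
    then show ?thesis by simp
  qed
  have flip': "flip z j = take k z @ flip (drop k z) (j - k)" if "k \<le> j" "j < length z" for j
    using flip[of "j - k"] that by simp
  have "(\<Sum>j\<in>{k..<length z}. p (flip z j)) = (\<Sum>j<length z - k. p (take k z @ flip (drop k z) j))"
    by (rule sum.reindex_bij_witness[of _ "\<lambda>j. j + k" "\<lambda>j. j - k"])
       (use assms flip' in auto)
  then show ?thesis
    using noisy_first_order[of "\<lambda>u. p (take k z @ u)" "drop k z"] by (simp add: obs_def hc_def)
qed

lemma hc_nonneg: "p u = 0 \<Longrightarrow> 0 \<le> hc k u"
  by (simp add: hc_def sum_nonneg nonneg)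

text \<open>Flipping the last letter gives the other continuation of \<open>w\<close>, which carries
  the whole mass of \<open>w\<close>. So such a word has probability exactly of order
  \<open>\<epsilon>\<close>.\<close>

lemma hc_snoc_pos:
  assumes "k \<le> length w" "p w > 0" "p (w @ [v]) = 0"
  shows "0 < hc k (w @ [v])"
proof -
  have "p (w @ [v]) + p (w @ [\<not> v]) = p w"
    using sum_snoc[of w] by (cases v) (simp_all add: UNIV_bool)
  then have "0 < p (flip (w @ [v]) (length w))" using assms by simp
  also have "\<dots> \<le> (\<Sum>j\<in>{k..<length (w @ [v])}. p (flip (w @ [v]) j))"
    by (rule member_le_sum) (use assms in \<open>auto simp: nonneg\<close>)
  finally show ?thesis using assms by (simp add: hc_def)
qed

lemma hc_snoc_dead:
  assumes "k \<le> length w" "p w = 0"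
  shows "hc k (w @ [v]) = (\<Sum>j\<in>{k..<length w}. p (flip w j @ [v]))"
proof -
  have 0: "p (w @ [a]) = 0" for a using snoc_le[of w a] nonneg[of "w @ [a]"] assms by simp
  have "{k..<length (w @ [v])} = insert (length w) {k..<length w}" using assms by auto
  then have "hc k (w @ [v]) = p (w @ [\<not> v]) + (\<Sum>j\<in>{k..<length w}. p (flip (w @ [v]) j))"
    \<comment> \<open>The flip of the last letter is split off; it contributes nothing because it
      leaves the forbidden \<open>w\<close> untouched.\<close>
    by (simp add: hc_def 0)
  also have "(\<Sum>j\<in>{k..<length w}. p (flip (w @ [v]) j)) = (\<Sum>j\<in>{k..<length w}. p (flip w j @ [v]))"
    by (intro sum.cong refl) (simp add: list_update_append nth_append)
  finally show ?thesis by (simp add: 0)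
qed

lemma hc_dead: "p w = 0 \<Longrightarrow> hc k w = (\<Sum>j\<in>{k..<length w}. p (flip w j))"
  by (simp add: hc_def)

text \<open>Ensures that for forbidden \<open>w\<close> the probability of \<open>wv\<close> can be
  of order \<open>\<epsilon>\<close> only if that of \<open>w\<close> is too.\<close>

lemma hc_snoc_dead_le:
  assumes "k \<le> length w" "p w = 0"
  shows "hc k (w @ [v]) \<le> hc k w"
  unfolding hc_snoc_dead[OF assms] hc_dead[OF assms(2)] by (intro sum_mono snoc_le)

definition f_term :: "nat \<Rightarrow> bool list \<Rightarrow> bool \<Rightarrow> real" where
  "f_term k w v = (if p w > 0 \<and> \<not> p (w @ [v]) > 0 then hc k (w @ [v]) else 0)"

text \<open>\<open>f_term\<close> and \<open>g_term\<close> are the coefficients of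
  \<open>\<epsilon> * ln \<epsilon>\<close> and \<open>\<epsilon>\<close> in one entropy term, so
  \<open>g_sum\<close> restores a sign, whereas for \<open>f_sum\<close> it is absorbed by passing
  to \<open>ln (1 / \<epsilon>)\<close>. The last guard is the condition of order exactly
  \<open>\<epsilon>\<close> on \<open>w\<close> and \<open>wv\<close>; see
  \<open>first_order_bigtheta_iff\<close>.\<close>

definition g_term :: "nat \<Rightarrow> bool list \<Rightarrow> bool \<Rightarrow> real" where
  "g_term k w v =
     (if p (w @ [v]) > 0 then hc k (w @ [v]) * ln (p (w @ [v]) / p w)
        + (hc k (w @ [v]) * p w - hc k w * p (w @ [v])) / p w else 0)
     + (if p w > 0 \<and> \<not> p (w @ [v]) > 0 then hc k (w @ [v]) * ln (hc k (w @ [v]) / p w) else 0)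
     + (if p w = 0 \<and> hc k w \<noteq> 0 \<and> hc k (w @ [v]) \<noteq> 0
        then hc k (w @ [v]) * ln (hc k (w @ [v]) / hc k w) else 0)"

lemma obs_pos_or_zero:
  "(\<forall>\<epsilon>. obs k \<epsilon> z = 0) \<or> (\<exists>c>0. \<exists>l. \<forall>\<epsilon>. 0 < \<epsilon> \<longrightarrow> \<epsilon> \<le> 1 / 2 \<longrightarrow> c * \<epsilon> ^ l \<le> obs k \<epsilon> z)"
proof (cases "\<forall>u\<in>words (length (drop k z)). p (take k z @ u) = 0")
  case True
  then show ?thesis by (auto simp: obs_def noisy_def)
next
  case False
  then obtain u where u: "length u = length (drop k z)" "p (take k z @ u) \<noteq> 0" by blast
  then have "p (take k z @ u) > 0" using nonneg[of "take k z @ u"] by simp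
  moreover have "\<forall>\<epsilon>. 0 < \<epsilon> \<longrightarrow> \<epsilon> \<le> 1 / 2 \<longrightarrow> p (take k z @ u) * \<epsilon> ^ length (drop k z) \<le> obs k \<epsilon> z"
    unfolding obs_def using u(1) by (intro allI impI noisy_lower[of "\<lambda>u. p (take k z @ u)" u] nonneg) auto
  ultimately show ?thesis by blast
qed

text \<open>Allowed \<open>wv\<close> gives a linear term; forbidden \<open>wv\<close> after allowed
  \<open>w\<close> gives the logarithmic one. If \<open>w\<close> is already forbidden, there is a
  linear term when one channel error explains \<open>wv\<close>, and a negligible one
  otherwise.\<close>

lemma entropy_term_obs_expansion:
  assumes k: "k \<le> length w"
  shows "(\<lambda>\<epsilon>. entropy_term (obs k \<epsilon> (w @ [v])) (obs k \<epsilon> w)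
           - (entropy_term (p (w @ [v])) (p w) + f_term k w v * (\<epsilon> * ln \<epsilon>) + g_term k w v * \<epsilon>))
         \<in> O[at_right 0](\<lambda>\<epsilon>. \<epsilon>\<^sup>2 * ln \<epsilon>)"
proof -
  note R = obs_first_order[OF k]
  have Q: "first_order (\<lambda>\<epsilon>. obs k \<epsilon> (w @ [v])) (p (w @ [v])) (hc k (w @ [v]))"
    using k by (intro obs_first_order) simp
  consider (alive) "p (w @ [v]) > 0" "p w > 0" | (dies) "p (w @ [v]) = 0" "p w > 0"
    | (dead) "p (w @ [v]) = 0" "p w = 0"
    using nonneg[of "w @ [v]"] nonneg[of w] snoc_le[of w v] by fastforce
  then show ?thesis
  proof cases
    case alive
    from landau_o.big_trans[OF entropy_term_expansion_pos[OF Q R alive, unfolded first_order_def] eps2_bigo_eps2_ln]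
    show ?thesis using alive by (simp add: f_term_def g_term_def)
  next
    case dies
    from entropy_term_expansion_lead[OF Q[unfolded dies] R hc_snoc_pos[OF k dies(2,1)] dies(2)]
    show ?thesis using dies by (simp add: f_term_def g_term_def)
  next
    case dead
    have h0: "0 \<le> hc k (w @ [v])" "0 \<le> hc k w" by (simp_all add: hc_nonneg dead)
    show ?thesis
    proof (cases "hc k (w @ [v]) = 0")
      case False
      then have pos: "0 < hc k (w @ [v])" "0 < hc k w"
        using h0 hc_snoc_dead_le[OF k dead(2), of v] by linarith+
      from landau_o.big_trans[OF entropy_term_expansion_both[OF Q[unfolded dead] R[unfolded dead] pos] eps2_bigo_eps2_ln]
      show ?thesis using dead pos by (simp add: f_term_def g_term_def)
    next
      case True
      have "(\<lambda>\<epsilon>. entropy_term (obs k \<epsilon> (w @ [v])) (obs k \<epsilon> w)) \<in> O[at_right 0](\<lambda>\<epsilon>. \<epsilon>\<^sup>2 * ln \<epsilon>)"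
        using obs_pos_or_zero[of k "w @ [v]"]
      proof (elim disjE exE conjE)
        fix c :: real and l :: nat
        assume c: "c > 0" and "\<forall>\<epsilon>. 0 < \<epsilon> \<longrightarrow> \<epsilon> \<le> 1 / 2 \<longrightarrow> c * \<epsilon> ^ l \<le> obs k \<epsilon> (w @ [v])"
        then show ?thesis
          using Q[unfolded dead True] k
          by (intro entropy_term_negligible[OF _ c]) (auto intro: obs_snoc_le obs_le_1)
      qed simp
      then show ?thesis using dead True by (simp add: f_term_def g_term_def)
    qed
  qed
qed

definition f_sum :: "nat \<Rightarrow> nat \<Rightarrow> real" where
  "f_sum n k = (\<Sum>w\<in>words n. \<Sum>v\<in>UNIV. f_term k w v)"

definition g_sum :: "nat \<Rightarrow> nat \<Rightarrow> real" where
  "g_sum n k = - (\<Sum>w\<in>words n. \<Sum>v\<in>UNIV. g_term k w v)"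

lemma cond_ent_obs_expansion:
  assumes k: "k \<le> n" and mn: "m \<le> n"
  shows "(\<lambda>\<epsilon>. cond_ent (obs k \<epsilon>) n - (rate + f_sum n k * (\<epsilon> * ln (1 / \<epsilon>)) + g_sum n k * \<epsilon>))
           \<in> O[at_right 0](\<lambda>\<epsilon>. \<epsilon>\<^sup>2 * ln \<epsilon>)"
proof -
  have "(\<lambda>\<epsilon>. \<Sum>w\<in>words n. \<Sum>v\<in>UNIV. entropy_term (obs k \<epsilon> (w @ [v])) (obs k \<epsilon> w)
           - (entropy_term (p (w @ [v])) (p w) + f_term k w v * (\<epsilon> * ln \<epsilon>) + g_term k w v * \<epsilon>))
         \<in> O[at_right 0](\<lambda>\<epsilon>. \<epsilon>\<^sup>2 * ln \<epsilon>)"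
    using k by (intro big_sum_in_bigo entropy_term_obs_expansion) auto
  then have "(\<lambda>\<epsilon>. - cond_ent (obs k \<epsilon>) n + rate - f_sum n k * (\<epsilon> * ln \<epsilon>) + g_sum n k * \<epsilon>)
         \<in> O[at_right 0](\<lambda>\<epsilon>. \<epsilon>\<^sup>2 * ln \<epsilon>)"
    unfolding rate_eq_cond_ent[OF mn] cond_ent_def f_sum_def g_sum_def
      sum_subtractf sum.distrib sum_distrib_right[symmetric]
    by (simp add: algebra_simps)
  then have "(\<lambda>\<epsilon>. - (- cond_ent (obs k \<epsilon>) n + rate - f_sum n k * (\<epsilon> * ln \<epsilon>) + g_sum n k * \<epsilon>))
         \<in> O[at_right 0](\<lambda>\<epsilon>. \<epsilon>\<^sup>2 * ln \<epsilon>)" by (simp only: landau_o.big.uminus_in_iff)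
  moreover have "\<forall>\<^sub>F \<epsilon> in at_right 0.
      cond_ent (obs k \<epsilon>) n - (rate + f_sum n k * (\<epsilon> * ln (1 / \<epsilon>)) + g_sum n k * \<epsilon>)
     = - (- cond_ent (obs k \<epsilon>) n + rate - f_sum n k * (\<epsilon> * ln \<epsilon>) + g_sum n k * \<epsilon>)"
    by (auto simp: eventually_at ln_div intro!: exI[of _ 1])
  ultimately show ?thesis by (rule bigo_eventually_eq[rotated])
qed

section \<open>Comparison of the coefficients\<close>

text \<open>Allowed words sharing at least \<open>m\<close> letters can be merged: the last
  \<open>m\<close> shared letters are a full state of the chain.\<close>

lemma pos_glue:
  assumes "m \<le> length x" "p (u @ x) > 0" "p (x @ s) > 0"
  shows "p (u @ x @ s) > 0"
proof -
  obtain x1 x2 where x: "x = x1 @ x2" "length x2 = m"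
    using assms(1) by (metis append_take_drop_id diff_diff_cancel length_drop)
  have "p (x2 @ s) > 0" using append_le_right[of x1 "x2 @ s"] assms(3) x by simp
  then have "p ((u @ x1) @ x2) * p (x2 @ s) > 0" using assms(2) x by simp
  then have "p ((u @ x1) @ x2 @ s) * p x2 > 0" using markov[OF x(2), of "u @ x1" s] by simp
  then have "p ((u @ x1) @ x2 @ s) > 0"
    using nonneg[of "(u @ x1) @ x2 @ s"] by (simp add: zero_less_mult_iff)
  then show ?thesis using x by simp
qed

lemma not_pos_iff: "\<not> p u > 0 \<longleftrightarrow> p u = 0"
  using nonneg[of u] by auto

definition letter_prob :: "bool list \<Rightarrow> bool \<Rightarrow> real" where
  "letter_prob s v = p (s @ [v]) / p s"

lemma p_snoc:
  assumes "length s = m"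
  shows "p (y @ s @ [v]) = p (y @ s) * letter_prob s v"
proof (cases "p s = 0")
  case True
  then have "p (s @ [v]) = 0" using snoc_le[of s v] nonneg[of "s @ [v]"] by simp
  then have "p (y @ s @ [v]) = 0"
    using append_le_right[of y "s @ [v]"] nonneg[of "y @ s @ [v]"] by simp
  then show ?thesis using True by (simp add: letter_prob_def)
next
  case False
  then show ?thesis using markov[OF assms, of y "[v]"] by (simp add: letter_prob_def field_simps)
qed

lemma flip_append: "j < length y \<Longrightarrow> flip (y @ s) j = flip y j @ s"
  by (simp add: list_update_append nth_append)

lemma flip_append_right: "length y \<le> j \<Longrightarrow> flip (y @ s) j = y @ flip s (j - length y)"
  by (simp add: list_update_append nth_append)

lemma hc_diff:
  assumes "m \<le> length u"
  shows "hc 0 u - hc m u = (\<Sum>j<m. p (flip u j) - p u)"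
proof -
  have "{0..<length u} = {..<m} \<union> {m..<length u}" using assms by auto
  then have "(\<Sum>j\<in>{0..<length u}. p (flip u j)) = (\<Sum>j<m. p (flip u j)) + (\<Sum>j\<in>{m..<length u}. p (flip u j))"
    by (simp only:, subst sum.union_disjoint) auto
  then show ?thesis using assms by (simp add: hc_def sum_subtractf of_nat_diff algebra_simps)
qed

text \<open>A flip among the first \<open>m\<close> letters cannot make \<open>wv\<close> allowed, because the last \<open>m\<close> letters of
  the allowed word \<open>w\<close> already determine that \<open>v\<close> is forbidden.\<close>

lemma hc_eq_of_forbidden:
  assumes n: "2 * m \<le> length w" and w: "p w > 0" and wv: "p (w @ [v]) = 0"
  shows "hc 0 (w @ [v]) = hc m (w @ [v])"
proof -
  \<comment> \<open>Since \<open>w\<close> has at least \<open>2 * m\<close> letters, the first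
    \<open>m\<close> of them lie in \<open>y\<close>, and flipping them leaves the state
    \<open>s\<close> alone.\<close>
  obtain y s where ys: "w = y @ s" "length s = m"
    using n by (metis append_take_drop_id diff_diff_cancel length_drop le_add2 le_trans mult_2)
  have "p (flip (w @ [v]) j) = 0" if "j < m" for j
  proof (rule ccontr)
    assume "p (flip (w @ [v]) j) \<noteq> 0"
    then have "p (flip y j @ s @ [v]) > 0"
      using that ys n flip_append[of j y "s @ [v]"] not_pos_iff by auto
    then have "p (s @ [v]) > 0" using append_le_right[of "flip y j" "s @ [v]"] by linarith
    then have "p (y @ s @ [v]) > 0" using w ys by (intro pos_glue) auto
    then show False using wv ys by simp
  qed
  then have "hc 0 (w @ [v]) - hc m (w @ [v]) = 0" using n wv by (subst hc_diff) auto
  then show ?thesis by simp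
qed

lemma f_sum_eq: "2 * m \<le> n \<Longrightarrow> f_sum n 0 = f_sum n m"
  unfolding f_sum_def f_term_def by (intro sum.cong refl) (auto simp: not_pos_iff hc_eq_of_forbidden)

text \<open>Isolates \<open>v\<close> in a factor determined by the last state \<open>s\<close>.
  What is left is the effect of the first \<open>m\<close> flips on \<open>w\<close> itself, which
  \<open>g_sum_eq\<close> removes by summing over \<open>y\<close>.\<close>

lemma g_term_diff:
  assumes s: "length s = m" and y: "2 * m \<le> length y"
  shows "g_term 0 (y @ s) v - g_term m (y @ s) v
       = (hc 0 (y @ s) - hc m (y @ s)) * (letter_prob s v * ln (letter_prob s v))"
proof -
  let ?w = "y @ s"
  let ?R = "letter_prob s v"
  have my: "m \<le> length y" using y by simp
  have pv: "p (?w @ [v]) = p ?w * ?R" using p_snoc[OF s] by simp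
  show ?thesis
  proof (cases "p ?w > 0")
    case alive: True
    have R: "p (?w @ [v]) / p ?w = ?R" using alive pv by simp
    show ?thesis
    proof (cases "p (?w @ [v]) > 0")
      case True
      have "hc 0 (?w @ [v]) - hc m (?w @ [v]) = (\<Sum>j<m. (p (flip ?w j) - p ?w) * ?R)"
      proof (subst hc_diff, use s in simp, intro sum.cong refl)
        fix j assume "j \<in> {..<m}"
        then have j: "j < length y" using my by simp
        show "p (flip (?w @ [v]) j) - p (?w @ [v]) = (p (flip ?w j) - p ?w) * ?R"
          using flip_append[OF j, of "s @ [v]"] flip_append[OF j, of s] p_snoc[OF s, of "flip y j" v]
          by (simp add: pv[simplified] left_diff_distrib)
      qed
      \<comment> \<open>The early flips do not touch \<open>s\<close>, so the transition probability
        factors out; this cancels the non-logarithmic parts of the two terms.\<close>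
      then have d: "hc 0 (?w @ [v]) - hc m (?w @ [v]) = (hc 0 ?w - hc m ?w) * ?R"
        using s by (simp add: hc_diff sum_distrib_right)
      have g: "g_term k ?w v = hc k (?w @ [v]) * ln ?R + (hc k (?w @ [v]) - hc k ?w * ?R)" for k
        using True alive by (simp add: g_term_def R[simplified] pv[simplified] diff_divide_distrib)
      have "g_term 0 ?w v - g_term m ?w v = (hc 0 (?w @ [v]) - hc m (?w @ [v])) * ln ?R
          + ((hc 0 (?w @ [v]) - hc m (?w @ [v])) - (hc 0 ?w - hc m ?w) * ?R)"
        unfolding g by (simp only: algebra_simps)
      then show ?thesis unfolding d by simp
    next
      case False
      then have "p (?w @ [v]) = 0" by (simp only: not_pos_iff)
      moreover from this have "?R = 0" using alive pv by simp
      ultimately show ?thesis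
        using alive hc_eq_of_forbidden[OF _ alive, of v] s y by (simp add: g_term_def)
    qed
  next
    case False
    then have dead: "p ?w = 0" by (simp only: not_pos_iff)
    then have dead': "p (?w @ [v]) = 0" using pv by simp
    have g: "g_term k ?w v = (if hc k ?w \<noteq> 0 \<and> hc k (?w @ [v]) \<noteq> 0
        then hc k (?w @ [v]) * ln (hc k (?w @ [v]) / hc k ?w) else 0)" for k
      using dead dead' by (simp add: g_term_def)
    show ?thesis
    \<comment> \<open>If no early flip makes \<open>w\<close> allowed, both superscripts give the
      same \<open>hc\<close>, for \<open>w\<close> and for \<open>wv\<close>, and the difference is
      zero.\<close>
    proof (cases "\<exists>j<m. p (flip ?w j) > 0")
      case False
      then have z: "p (flip ?w j) = 0" if "j < m" for j using that not_pos_iff by blast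
      have "p (flip (?w @ [v]) j) = 0" if "j < m" for j
        using z[OF that] that my flip_append[of j ?w "[v]"] snoc_le[of "flip ?w j" v]
          nonneg[of "flip ?w j @ [v]"] by simp
      then have "hc 0 (?w @ [v]) - hc m (?w @ [v]) = 0" using s dead' by (subst hc_diff) auto
      moreover have "hc 0 ?w - hc m ?w = 0" using z s dead by (subst hc_diff) auto
      ultimately show ?thesis unfolding g by simp
    next
      case True
      then obtain j where j: "j < m" "p (flip ?w j) > 0" by blast
      \<comment> \<open>Here \<open>2 * m \<le> length y\<close> enters: \<open>x\<close> is out of
        reach of the early flips, yet long enough to glue along.\<close>
      obtain y0 x where yx: "y = y0 @ x" "length y0 = m" "m \<le> length x"
        using y by (metis append_take_drop_id length_take min.absorb2 my length_drop add_le_imp_le_diff mult_2)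
      have "p (flip y0 j @ (x @ s)) > 0" using j yx flip_append[of j y0 "x @ s"] by simp
      then have xs: "p (x @ s) > 0" using append_le_right[of "flip y0 j" "x @ s"] by linarith
      \<comment> \<open>If one of the first \<open>m\<close> flips is allowed, a flip in \<open>s\<close> is not, as the two words overlap in \<open>x\<close>
        and glue to \<open>w\<close>; hence the transition from \<open>s\<close> factors out of \<open>hc k (wv)\<close>.\<close>
      have late: "p (y @ s') = 0" for s'
      proof (rule ccontr)
        assume "p (y @ s') \<noteq> 0"
        then have "p (y0 @ x) > 0" using append_le_left[of y s'] yx not_pos_iff[of "y @ s'"] by simp
        then have "p (y0 @ x @ s) > 0" by (rule pos_glue[OF yx(3) _ xs])
        then show False using dead yx by simp
      qed
      have flips: "p (flip ?w i @ [v]) = p (flip ?w i) * ?R" for i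
      proof (cases "i < length y")
        case True
        then show ?thesis using p_snoc[OF s, of "flip y i" v] by (simp only: flip_append append_assoc)
      next
        case False
        then show ?thesis by (simp only: flip_append_right[of y i s] late append_assoc)
      qed
      have h: "hc k (?w @ [v]) = hc k ?w * ?R" if "k \<le> m" for k
        using that s by (simp only: hc_snoc_dead[OF _ dead] hc_dead[OF dead] length_append trans_le_add2
            flips sum_distrib_right)
      have "g_term k ?w v = hc k ?w * (?R * ln ?R)" if "k \<le> m" for k
        unfolding g h[OF that] by auto
      then show ?thesis by (simp add: left_diff_distrib)
    qed
  qed
qed

text \<open>Summing over the first part \<open>y\<close> of the word, the flips among the first \<open>m\<close> letters cancel,
  since flipping is a bijection that leaves the suffix \<open>s\<close> alone.\<close>

lemma g_sum_eq:
  assumes n: "3 * m \<le> n"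
  shows "g_sum n 0 = g_sum n m"
proof -
  define a where "a = n - m"
  have a: "n = a + m" "2 * m \<le> a" using n by (auto simp: a_def)
  define L where "L s = (\<Sum>v\<in>UNIV. letter_prob s v * ln (letter_prob s v))" for s
  have flip_sum: "(\<Sum>y\<in>words a. p (flip y j @ s)) = (\<Sum>y\<in>words a. p (y @ s))" if "j < m" for j s
    by (rule sum.reindex_bij_witness[of _ "\<lambda>y. flip y j" "\<lambda>y. flip y j"]) (use that a in auto)
  have "(\<Sum>w\<in>words n. \<Sum>v\<in>UNIV. g_term 0 w v) - (\<Sum>w\<in>words n. \<Sum>v\<in>UNIV. g_term m w v)
      = (\<Sum>y\<in>words a. \<Sum>s\<in>words m. \<Sum>v\<in>UNIV. g_term 0 (y @ s) v - g_term m (y @ s) v)"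
    by (simp add: a(1) sum_words_add sum_subtractf)
  also have "\<dots> = (\<Sum>y\<in>words a. \<Sum>s\<in>words m. (hc 0 (y @ s) - hc m (y @ s)) * L s)"
    by (intro sum.cong refl) (use a in \<open>simp add: g_term_diff L_def sum_distrib_left\<close>)
  also have "\<dots> = (\<Sum>y\<in>words a. \<Sum>s\<in>words m. \<Sum>j<m. (p (flip y j @ s) - p (y @ s)) * L s)"
    by (intro sum.cong refl) (use a in \<open>simp add: hc_diff flip_append sum_distrib_right\<close>)
  also have "\<dots> = (\<Sum>s\<in>words m. \<Sum>y\<in>words a. \<Sum>j<m. (p (flip y j @ s) - p (y @ s)) * L s)"
    by (rule sum.swap)
  also have "\<dots> = (\<Sum>s\<in>words m. \<Sum>j<m. \<Sum>y\<in>words a. (p (flip y j @ s) - p (y @ s)) * L s)"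
    by (intro sum.cong refl sum.swap)
  also have "\<dots> = 0"
  proof -
    have "(\<Sum>y\<in>words a. (p (flip y j @ s) - p (y @ s)) * L s) = 0" if "j < m" for j s
      using flip_sum[OF that, of s] by (simp add: sum_subtractf flip: sum_distrib_right)
    then show ?thesis by (simp add: sum.neutral)
  qed
  finally show ?thesis by (simp add: g_sum_def)
qed

section \<open>Expansion of the entropy rate from its two bounds\<close>

lemma rate_obs_bounds_eventually:
  assumes "m \<le> n"
  shows "\<forall>\<^sub>F \<epsilon> in at_right 0. cond_ent (obs m \<epsilon>) n - c \<epsilon> \<le> stationary_words.rate (obs 0 \<epsilon>) - c \<epsilon>
           \<and> stationary_words.rate (obs 0 \<epsilon>) - c \<epsilon> \<le> cond_ent (obs 0 \<epsilon>) n - c \<epsilon>"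
  using rate_obs_bounds[OF _ _ assms] by (auto simp: eventually_at intro!: exI[of _ 1])

text \<open>At this accuracy the linear term belongs to the error, so agreement of the logarithmic
  coefficients, available from \<open>2 * m\<close> on, is enough.\<close>

lemma rate_obs_leading:
  assumes n: "2 * m \<le> n"
  shows "(\<lambda>\<epsilon>. stationary_words.rate (obs 0 \<epsilon>) - (rate + f_sum n 0 * (\<epsilon> * ln (1 / \<epsilon>))))
           \<in> O[at_right 0](\<lambda>\<epsilon>. \<epsilon>)"
proof -
  have *: "(\<lambda>\<epsilon>. cond_ent (obs k \<epsilon>) n - (rate + f_sum n 0 * (\<epsilon> * ln (1 / \<epsilon>)))) \<in> O[at_right 0](\<lambda>\<epsilon>. \<epsilon>)"
    if k: "k = 0 \<or> k = m" for k
  proof -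
    have fk: "f_sum n k = f_sum n 0" using k f_sum_eq[OF n] by auto
    have "(\<lambda>\<epsilon>. (cond_ent (obs k \<epsilon>) n - (rate + f_sum n k * (\<epsilon> * ln (1 / \<epsilon>)) + g_sum n k * \<epsilon>))
        + g_sum n k * \<epsilon>) \<in> O[at_right 0](\<lambda>\<epsilon>. \<epsilon>)"
      by (rule sum_in_bigo(1)[OF landau_o.big_trans[OF cond_ent_obs_expansion eps2_ln_bigo_eps]])
         (use k n in auto)
    then show ?thesis by (simp add: fk algebra_simps)
  qed
  have "m \<le> n" using n by simp
  then show ?thesis
    by (intro bigo_sandwich[OF *[of m] *[of 0]] rate_obs_bounds_eventually) auto
qed

text \<open>Both numbers are the leading coefficient of one and the same function, which determines
  it.\<close>

lemma f_sum_stable: "f_sum (3 * m) 0 = f_sum (2 * m) 0"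
proof -
  have "(\<lambda>\<epsilon>. (stationary_words.rate (obs 0 \<epsilon>) - (rate + f_sum (2 * m) 0 * (\<epsilon> * ln (1 / \<epsilon>))))
      - (stationary_words.rate (obs 0 \<epsilon>) - (rate + f_sum (3 * m) 0 * (\<epsilon> * ln (1 / \<epsilon>)))))
      \<in> O[at_right 0](\<lambda>\<epsilon>. \<epsilon>)"
    by (intro sum_in_bigo rate_obs_leading) auto
  then have "(\<lambda>\<epsilon>. (f_sum (3 * m) 0 - f_sum (2 * m) 0) * (\<epsilon> * ln (1 / \<epsilon>))) \<in> O[at_right 0](\<lambda>\<epsilon>. \<epsilon>)"
    by (simp add: algebra_simps)
  then show ?thesis using eps_ln_not_bigo_eps by fastforce
qed

lemma rate_obs_expansion:
  "(\<lambda>\<epsilon>. stationary_words.rate (obs 0 \<epsilon>)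
      - (rate + f_sum (2 * m) 0 * (\<epsilon> * ln (1 / \<epsilon>)) + g_sum (3 * m) 0 * \<epsilon>))
     \<in> O[at_right 0](\<lambda>\<epsilon>. \<epsilon>\<^sup>2 * ln \<epsilon>)"
proof (rule bigo_sandwich[OF _ _ rate_obs_bounds_eventually])
  show "(\<lambda>\<epsilon>. cond_ent (obs m \<epsilon>) (3 * m)
      - (rate + f_sum (2 * m) 0 * (\<epsilon> * ln (1 / \<epsilon>)) + g_sum (3 * m) 0 * \<epsilon>))
      \<in> O[at_right 0](\<lambda>\<epsilon>. \<epsilon>\<^sup>2 * ln \<epsilon>)"
    using cond_ent_obs_expansion[of m "3 * m"] f_sum_eq[of "3 * m"] g_sum_eq[of "3 * m"] f_sum_stable
    by simp
  show "(\<lambda>\<epsilon>. cond_ent (obs 0 \<epsilon>) (3 * m)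
      - (rate + f_sum (2 * m) 0 * (\<epsilon> * ln (1 / \<epsilon>)) + g_sum (3 * m) 0 * \<epsilon>))
      \<in> O[at_right 0](\<lambda>\<epsilon>. \<epsilon>\<^sup>2 * ln \<epsilon>)"
    using cond_ent_obs_expansion[of 0 "3 * m"] f_sum_stable by simp
qed simp

end

section \<open>Word probabilities of a process\<close>

lemma block_eq_iff: "block W t l \<omega> = e \<longleftrightarrow> length e = l \<and> (\<forall>j<l. W (t + int j) \<omega> = e ! j)"
  by (auto simp: block_def list_eq_iff_nth_eq)

lemma block_0 [simp]: "block W t 0 \<omega> = []"
  by (simp add: block_def)

lemma block_add: "block W t (k + l) \<omega> = block W t k \<omega> @ block W (t + int k) l \<omega>"
  by (rule nth_equalityI) (auto simp: block_def nth_append)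

lemma block_Suc: "block W t (Suc l) \<omega> = block W t l \<omega> @ [W (t + int l) \<omega>]"
  by (simp add: block_def)

lemma block_Suc_Cons: "block W t (Suc l) \<omega> = W t \<omega> # block W (t + 1) l \<omega>"
  using block_add[of W t 1 l] by (simp add: block_def)

lemma block_shift: "block (\<lambda>i. W (i - s)) t l \<omega> = block W (t - s) l \<omega>"
  by (simp add: block_def algebra_simps)

lemma block_trajectory:
  "(\<And>j. j < l \<Longrightarrow> t + int j \<in> I) \<Longrightarrow> block (\<lambda>i \<tau>. \<tau> i) t l (trajectory I W \<omega>) = block W t l \<omega>"
  by (auto simp: block_def trajectory_def)

lemma block_trajectory_sets:
  assumes "\<And>j. j < l \<Longrightarrow> t + int j \<in> I"
  shows "{\<tau> \<in> space (traj_space I). block (\<lambda>i \<tau>. \<tau> i) t l \<tau> = u} \<in> sets (traj_space I)"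
proof -
  have "block (\<lambda>i \<tau>. \<tau> i) t l \<in> traj_space I \<rightarrow>\<^sub>M count_space UNIV"
    using assms by (intro measurable_block measurable_component_singleton) auto
  from measurable_sets[OF this, of "{u}"] show ?thesis by (simp add: vimage_def Int_def conj_commute)
qed

lemma trajectory_in_space: "trajectory I W \<omega> \<in> space (traj_space I)"
  by (simp add: space_PiM trajectory_def)

lemma measurable_trajectory:
  "(\<And>i. i \<in> I \<Longrightarrow> W i \<in> M \<rightarrow>\<^sub>M count_space UNIV) \<Longrightarrow> trajectory I W \<in> M \<rightarrow>\<^sub>M traj_space I"
  unfolding trajectory_def by (rule measurable_restrict)

lemma trajectory_vimage_block:
  assumes "\<And>j. j < l \<Longrightarrow> t + int j \<in> I"
  shows "trajectory I W -` {\<tau> \<in> space (traj_space I). block (\<lambda>i \<tau>. \<tau> i) t l \<tau> = u} \<inter> space M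
       = {\<omega> \<in> space M. block W t l \<omega> = u}"
  using block_trajectory[where I = I and t = t and l = l and W = W, OF assms]
  by (auto simp: trajectory_in_space)

text \<open>Kept apart from stationarity because the noise is an instance as well.\<close>

locale binary_source = prob_space M for M :: "'a measure" +
  fixes X :: "int \<Rightarrow> 'a \<Rightarrow> bool"
  assumes measurable_source: "i \<le> 0 \<Longrightarrow> X i \<in> M \<rightarrow>\<^sub>M count_space UNIV"
begin

lemma block_event:
  assumes "t + int l \<le> 1"
  shows "{\<omega> \<in> space M. block X t l \<omega> = u} \<in> events"
proof -
  have "block X t l \<in> M \<rightarrow>\<^sub>M count_space UNIV"
    using assms by (intro measurable_block measurable_source) auto
  from measurable_sets[OF this, of "{u}"] show ?thesis by (simp add: vimage_def Int_def conj_commute)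
qed

lemma prob_block_snoc:
  assumes "t + int (Suc l) \<le> 1"
  shows "(\<Sum>v\<in>UNIV. \<P>(\<omega> in M. block X t (Suc l) \<omega> = u @ [v])) = \<P>(\<omega> in M. block X t l \<omega> = u)"
  using assms
  by (intro prob_sum[symmetric] block_event AE_I2) (auto simp: block_Suc)

lemma prob_block_Cons:
  assumes "t + int (Suc l) \<le> 1"
  shows "(\<Sum>a\<in>UNIV. \<P>(\<omega> in M. block X t (Suc l) \<omega> = a # u)) = \<P>(\<omega> in M. block X (t + 1) l \<omega> = u)"
  using assms
  by (intro prob_sum[symmetric] block_event AE_I2) (auto simp: block_Suc_Cons)

end

locale stationary_source = binary_source +
  assumes stationary: "stationary M X"
begin

text \<open>The bound on \<open>t\<close> keeps the block at times up to 0, so its event is a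
  cylinder set for the trajectory law whose invariance is assumed.\<close>

lemma prob_block_shift:
  assumes "t + int l \<le> 1"
  shows "\<P>(\<omega> in M. block X (t - int s) l \<omega> = u) = \<P>(\<omega> in M. block X t l \<omega> = u)"
proof -
  let ?A = "{\<tau> \<in> space (traj_space {..0}). block (\<lambda>i \<tau>. \<tau> i) t l \<tau> = u}"
  have t: "\<And>j. j < l \<Longrightarrow> t + int j \<in> {..0}" using assms by auto
  have *: "measure (distr M (traj_space {..0}) (trajectory {..0} W)) ?A = \<P>(\<omega> in M. block W t l \<omega> = u)"
    if "\<And>i. i \<le> 0 \<Longrightarrow> W i \<in> M \<rightarrow>\<^sub>M count_space UNIV" for W
    using that t by (subst measure_distr[OF measurable_trajectory block_trajectory_sets])
      (simp_all only: trajectory_vimage_block[where M = M, OF t] atMost_iff)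
  have "\<P>(\<omega> in M. block (\<lambda>i. X (i - int s)) t l \<omega> = u) = \<P>(\<omega> in M. block X t l \<omega> = u)"
    using stationary *[of "\<lambda>i. X (i - int s)"] *[of X] measurable_source
    by (simp add: stationary_def)
  then show ?thesis by (simp add: block_shift)
qed

lemma prob_block_eq_word_prob:
  assumes "t + int (length u) \<le> 1"
  shows "\<P>(\<omega> in M. block X t (length u) \<omega> = u) = word_prob M X u"
proof -
  have "t = (1 - int (length u)) - int (nat (1 - int (length u) - t))" using assms by simp
  then show ?thesis using prob_block_shift[of "1 - int (length u)" "length u" "nat (1 - int (length u) - t)" u]
    by (simp add: word_prob_def)
qed

lemma stationary_words_word_prob: "stationary_words (word_prob M X)"
proof
  show "0 \<le> word_prob M X u" for u by (simp add: word_prob_def)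
  show "word_prob M X [] = 1" by (simp add: word_prob_def prob_space)
  show "(\<Sum>v\<in>UNIV. word_prob M X (u @ [v])) = word_prob M X u" for u
    using prob_block_snoc[of "- int (length u)" "length u" u] prob_block_eq_word_prob[of "- int (length u)" u]
    by (simp add: word_prob_def)
  show "(\<Sum>a\<in>UNIV. word_prob M X (a # u)) = word_prob M X u" for u
    using prob_block_Cons[of "- int (length u)" "length u" u]
    by (simp add: word_prob_def algebra_simps)
qed

text \<open>Integrate the conditional probability over the event that the word \<open>u @ x\<close>
  ends at time -1. This event belongs to the past, and on it the conditional probability is the
  constant \<open>q x\<close>; one \<open>q\<close> serves all \<open>u\<close>.\<close>

lemma word_prob_snoc_markov:
  assumes markov: "markov_of_order M m X"
  obtains q where "\<And>u x. length x = m \<Longrightarrow> word_prob M X (u @ x @ [a]) = q x * word_prob M X (u @ x)"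
proof -
  obtain q where q: "AE \<omega> in M. real_cond_exp M (past M X 0) (indicator {\<omega>\<in>space M. X 0 \<omega> = a}) \<omega>
                   = q (block X (- int m) m \<omega>)"
    using markov unfolding markov_of_order_def by force
  let ?F = "past M X 0"
  let ?B = "{\<omega>\<in>space M. X 0 \<omega> = a}"
  have traj: "trajectory {..<0} X \<in> M \<rightarrow>\<^sub>M traj_space {..<0}"
    by (intro measurable_trajectory measurable_source) auto
  have "subalgebra M ?F"
    unfolding subalgebra_def past_def
    using measurable_sets[OF traj] by (auto simp: sets_vimage_algebra intro!: sets.sigma_sets_subset)
  then interpret F: finite_measure_subalgebra M ?F by unfold_locales
  have B: "?B \<in> events"
    using block_event[of 0 1 "[a]"] by (simp add: block_def)
  have "word_prob M X (u @ x @ [a]) = q x * word_prob M X (u @ x)" if x: "length x = m" for u x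
  proof -
    let ?l = "length (u @ x)"
    let ?A = "{\<omega> \<in> space M. block X (- int ?l) ?l \<omega> = u @ x}"
    have A: "?A \<in> events" by (intro block_event) auto
    have "trajectory {..<0} X -` {\<tau> \<in> space (traj_space {..<0}). block (\<lambda>i \<tau>. \<tau> i) (- int ?l) ?l \<tau> = u @ x} \<inter> space M
        \<in> sets ?F"
      unfolding past_def by (intro in_vimage_algebra block_trajectory_sets) auto
    then have AF: "?A \<in> sets ?F" by (subst (asm) trajectory_vimage_block) auto
    have on_A: "block X (- int m) m \<omega> = x" if "\<omega> \<in> ?A" for \<omega>
      using that x block_add[of X "- int ?l" "length u" m \<omega>] by auto
    have "(\<integral>\<omega>\<in>?A. indicator ?B \<omega> \<partial>M) = (\<integral>\<omega>\<in>?A. real_cond_exp M ?F (indicator ?B) \<omega> \<partial>M)"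
      using B AF by (intro F.real_cond_exp_intA) (auto simp: less_top[symmetric])
    also have "\<dots> = (\<integral>\<omega>\<in>?A. q x \<partial>M)"
      unfolding set_lebesgue_integral_def
    proof (rule integral_cong_AE)
      show "AE \<omega> in M. indicat_real ?A \<omega> *\<^sub>R real_cond_exp M ?F (indicat_real ?B) \<omega> = indicat_real ?A \<omega> *\<^sub>R q x"
        using q by eventually_elim (auto simp: indicator_def on_A)
    qed (use A in auto)
    also have "\<dots> = q x * prob ?A" using A by (simp add: set_lebesgue_integral_def)
    also have "(\<integral>\<omega>\<in>?A. indicator ?B \<omega> \<partial>M) = prob (?A \<inter> ?B)"
      using A B by (simp add: set_lebesgue_integral_def flip: indicator_inter_arith)
    also have "?A \<inter> ?B = {\<omega> \<in> space M. block X (- int ?l) (Suc ?l) \<omega> = (u @ x) @ [a]}"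
      by (auto simp: block_Suc)
    also have "prob \<dots> = word_prob M X (u @ x @ [a])" by (simp add: word_prob_def)
    also have "prob ?A = word_prob M X (u @ x)" by (rule prob_block_eq_word_prob) simp
    finally show ?thesis .
  qed
  then show ?thesis by (rule that)
qed

lemma markov_words_word_prob:
  assumes markov: "markov_of_order M m X"
  shows "markov_words (word_prob M X) m"
proof -
  interpret p: stationary_words "word_prob M X" by (rule stationary_words_word_prob)
  show ?thesis
  proof
    fix x u s :: "bool list" assume x: "length x = m"
    show "word_prob M X (u @ x @ s) * word_prob M X x = word_prob M X (u @ x) * word_prob M X (x @ s)"
    proof (induction s rule: rev_induct)
      case (snoc a s)
      obtain q where q: "\<And>u x. length x = m \<Longrightarrow> word_prob M X (u @ x @ [a]) = q x * word_prob M X (u @ x)"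
        using word_prob_snoc_markov[OF markov] by blast
      \<comment> \<open>The next letter depends on \<open>z\<close>, the last \<open>m\<close>
        letters, which \<open>x @ s\<close> and \<open>u @ x @ s\<close> share; hence both sides
        acquire the same factor \<open>q z\<close>.\<close>
      obtain y z where yz: "x @ s = y @ z" "length z = m"
        using x by (metis append_take_drop_id diff_diff_cancel le_add1 length_append length_drop)
      have "word_prob M X (u @ x @ s @ [a]) = q z * word_prob M X (u @ x @ s)"
        using q[OF yz(2), of "u @ y"] yz(1) by (metis append_assoc)
      moreover have "word_prob M X (x @ s @ [a]) = q z * word_prob M X (x @ s)"
        using q[OF yz(2), of y] yz(1) by (metis append_assoc)
      ultimately show ?case using snoc by simp
    qed simp
  qed
qed

end

section \<open>The channel output\<close>

lemma bsc_kernel_eq_prod: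
  "length u = length z \<Longrightarrow> bsc_kernel \<epsilon> u z = (\<Prod>j<length z. if u ! j = z ! j then 1 - \<epsilon> else \<epsilon>)"
  by (induction u z rule: list_induct2) (simp_all add: prod.lessThan_Suc_shift del: prod.lessThan_Suc)

locale noisy_source = stationary_source +
  fixes \<epsilon> :: real and N :: "int \<Rightarrow> 'a \<Rightarrow> bool"
  assumes noise: "bsc_noise M X \<epsilon> N"
begin

lemma measurable_noise: "i \<le> 0 \<Longrightarrow> N i \<in> M \<rightarrow>\<^sub>M count_space UNIV"
  using noise unfolding bsc_noise_def indep_vars_def by auto

lemma noise_source: "binary_source M N"
  by unfold_locales (rule measurable_noise)

lemma prob_noise_letter:
  assumes "i \<le> 0"
  shows "prob (N i -` {b} \<inter> space M) = (if b then \<epsilon> else 1 - \<epsilon>)"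
proof -
  have 1: "prob {\<omega> \<in> space M. N i \<omega>} = \<epsilon>" using noise assms by (simp add: bsc_noise_def)
  have "N i -` {True} \<inter> space M \<in> events" using measurable_noise[OF assms] by (rule measurable_sets) simp
  then have ev: "{\<omega> \<in> space M. N i \<omega>} \<in> events" by (simp add: vimage_def Int_def conj_commute)
  show ?thesis
  proof (cases b)
    case True
    then show ?thesis using 1 by (simp add: vimage_def Int_def conj_commute)
  next
    case False
    then have "N i -` {b} \<inter> space M = space M - {\<omega> \<in> space M. N i \<omega>}" by auto
    then show ?thesis using False prob_compl[OF ev] 1 by simp
  qed
qed

lemma prob_noise_block:
  assumes "t + int (length e) \<le> 1"
  shows "\<P>(\<omega> in M. block N t (length e) \<omega> = e) = (\<Prod>j<length e. if e ! j then \<epsilon> else 1 - \<epsilon>)"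
\<comment> \<open>The empty word is separate, since an intersection over no indices need not be
  \<open>space M\<close>.\<close>
proof (cases "length e = 0")
  case True
  then show ?thesis by (simp add: prob_space)
next
  case False
  let ?J = "{t..<t + int (length e)}"
  have "{\<omega> \<in> space M. block N t (length e) \<omega> = e} = (\<Inter>i\<in>?J. N i -` {e ! nat (i - t)} \<inter> space M)"
  proof (intro equalityI subsetI)
    fix \<omega> assume "\<omega> \<in> {\<omega> \<in> space M. block N t (length e) \<omega> = e}"
    then have w: "\<omega> \<in> space M" "\<And>j. j < length e \<Longrightarrow> N (t + int j) \<omega> = e ! j" by (auto simp: block_eq_iff)
    have "N i \<omega> = e ! nat (i - t)" if "i \<in> ?J" for i using w(2)[of "nat (i - t)"] that by auto
    then show "\<omega> \<in> (\<Inter>i\<in>?J. N i -` {e ! nat (i - t)} \<inter> space M)" using w(1) by auto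
  next
    fix \<omega> assume w: "\<omega> \<in> (\<Inter>i\<in>?J. N i -` {e ! nat (i - t)} \<inter> space M)"
    have "N (t + int j) \<omega> = e ! j" if "j < length e" for j
    proof -
      have "t + int j \<in> ?J" using that by simp
      then have "\<omega> \<in> N (t + int j) -` {e ! nat (t + int j - t)} \<inter> space M" using w by blast
      then show ?thesis by simp
    qed
    moreover have "t \<in> ?J" using False by simp
    then have "\<omega> \<in> space M" using w by blast
    ultimately show "\<omega> \<in> {\<omega> \<in> space M. block N t (length e) \<omega> = e}" by (auto simp: block_eq_iff)
  qed
  also have "prob \<dots> = (\<Prod>i\<in>?J. prob (N i -` {e ! nat (i - t)} \<inter> space M))"
    using noise assms False by (intro indep_varsD) (auto simp: bsc_noise_def)
  also have "\<dots> = (\<Prod>i\<in>?J. if e ! nat (i - t) then \<epsilon> else 1 - \<epsilon>)"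
    using assms by (intro prod.cong refl prob_noise_letter) auto
  also have "\<dots> = (\<Prod>j<length e. if e ! j then \<epsilon> else 1 - \<epsilon>)"
    by (rule prod.reindex_bij_witness[of _ "\<lambda>j. t + int j" "\<lambda>i. nat (i - t)"]) auto
  finally show ?thesis .
qed

lemma prob_block_noise:
  assumes "t + int l \<le> 1" "t' + int (length e) \<le> 1"
  shows "\<P>(\<omega> in M. block X t l \<omega> = u \<and> block N t' (length e) \<omega> = e)
       = \<P>(\<omega> in M. block X t l \<omega> = u) * (\<Prod>j<length e. if e ! j then \<epsilon> else 1 - \<epsilon>)"
proof -
  let ?S = "\<lambda>t l u. {\<tau> \<in> space (traj_space {..0}). block (\<lambda>i \<tau>. \<tau> i) t l \<tau> = u}"
  have t: "\<And>j. j < l \<Longrightarrow> t + int j \<in> {..0}" "\<And>j. j < length e \<Longrightarrow> t' + int j \<in> {..0}"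
    using assms by auto
  have indep: "indep_var (traj_space {..0}) (trajectory {..0} X) (traj_space {..0}) (trajectory {..0} N)"
    using noise by (simp add: bsc_noise_def)
  have "prob ((\<lambda>\<omega>. (trajectory {..0} X \<omega>, trajectory {..0} N \<omega>)) -` (?S t l u \<times> ?S t' (length e) e) \<inter> space M)
     = prob (trajectory {..0} X -` ?S t l u \<inter> space M) * prob (trajectory {..0} N -` ?S t' (length e) e \<inter> space M)"
    by (rule indep_varD[OF indep block_trajectory_sets block_trajectory_sets]) (use t in auto)
  also have "(\<lambda>\<omega>. (trajectory {..0} X \<omega>, trajectory {..0} N \<omega>)) -` (?S t l u \<times> ?S t' (length e) e) \<inter> space M
     = (trajectory {..0} X -` ?S t l u \<inter> space M) \<inter> (trajectory {..0} N -` ?S t' (length e) e \<inter> space M)"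
    by auto
  also have "trajectory {..0} X -` ?S t l u \<inter> space M = {\<omega> \<in> space M. block X t l \<omega> = u}"
    by (rule trajectory_vimage_block) (rule t(1))
  also have "trajectory {..0} N -` ?S t' (length e) e \<inter> space M = {\<omega> \<in> space M. block N t' (length e) \<omega> = e}"
    by (rule trajectory_vimage_block) (rule t(2))
  also have "{\<omega> \<in> space M. block X t l \<omega> = u} \<inter> {\<omega> \<in> space M. block N t' (length e) \<omega> = e}
     = {\<omega> \<in> space M. block X t l \<omega> = u \<and> block N t' (length e) \<omega> = e}" by auto
  finally show ?thesis unfolding prob_noise_block[OF assms(2)] .
qed

lemma block_output_iff:
  "block (bsc_output X N) t l \<omega> = z \<longleftrightarrow>
     length z = l \<and> block N t l \<omega> = map2 (\<noteq>) (block X t l \<omega>) z"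
  by (auto simp: block_eq_iff bsc_output_def) (auto simp: block_def)

text \<open>Sum over the source letters \<open>u\<close> underneath \<open>z\<close>. Given
  \<open>u\<close>, the noise must be the letterwise difference of \<open>u\<close> and
  \<open>z\<close>; independence makes its probability the kernel factor.\<close>

lemma prob_block_output:
  assumes "t + int (length a) + int (length z) \<le> 1"
  shows "\<P>(\<omega> in M. block X t (length a) \<omega> = a
                  \<and> block (bsc_output X N) (t + int (length a)) (length z) \<omega> = z)
       = noisy (\<lambda>u. word_prob M X (a @ u)) \<epsilon> z"
proof -
  interpret N: binary_source M N by (rule noise_source)
  let ?t = "t + int (length a)" and ?l = "length a + length z"
  let ?P = "\<lambda>u \<omega>. block X t ?l \<omega> = a @ u \<and> block N ?t (length z) \<omega> = map2 (\<noteq>) u z"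
  have ev: "{\<omega> \<in> space M. ?P u \<omega>} \<in> events" for u
    using assms by (intro sets.sets_Collect_conj block_event N.block_event) auto
  have iff: "block X t (length a) \<omega> = a \<and> block (bsc_output X N) ?t (length z) \<omega> = z
      \<longleftrightarrow> ?P (block X ?t (length z) \<omega>) \<omega>" for \<omega>
    by (auto simp: block_output_iff block_add)
  have "{\<omega> \<in> space M. block X t (length a) \<omega> = a \<and> block (bsc_output X N) ?t (length z) \<omega> = z}
      = (\<Union>u\<in>words (length z). {\<omega> \<in> space M. ?P u \<omega>})"
    unfolding iff by (auto simp: block_add)
  then have ev': "{\<omega> \<in> space M. block X t (length a) \<omega> = a \<and> block (bsc_output X N) ?t (length z) \<omega> = z} \<in> events"
    using ev finite_words by (auto intro: sets.finite_UN)
  have "\<P>(\<omega> in M. block X t (length a) \<omega> = a \<and> block (bsc_output X N) ?t (length z) \<omega> = z)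
      = (\<Sum>u\<in>words (length z). \<P>(\<omega> in M. ?P u \<omega>))"
    by (rule prob_sum[OF finite_words ev ev'], rule AE_I2, unfold iff) (auto simp: block_add)
  also have "\<dots> = (\<Sum>u\<in>words (length z). word_prob M X (a @ u) * bsc_kernel \<epsilon> u z)"
  proof (intro sum.cong refl)
    fix u assume "u \<in> words (length z)"
    then have u: "length u = length z" by simp
    have "\<P>(\<omega> in M. ?P u \<omega>) = \<P>(\<omega> in M. block X t ?l \<omega> = a @ u)
        * (\<Prod>j<length z. if map2 (\<noteq>) u z ! j then \<epsilon> else 1 - \<epsilon>)"
      using prob_block_noise[of t ?l ?t "map2 (\<noteq>) u z" "a @ u"] assms u by simp
    also have "\<P>(\<omega> in M. block X t ?l \<omega> = a @ u) = word_prob M X (a @ u)"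
      using prob_block_eq_word_prob[of t "a @ u"] assms u by simp
    also have "(\<Prod>j<length z. if map2 (\<noteq>) u z ! j then \<epsilon> else 1 - \<epsilon>) = bsc_kernel \<epsilon> u z"
      unfolding bsc_kernel_eq_prod[OF u] using u by (intro prod.cong refl) auto
    finally show "\<P>(\<omega> in M. ?P u \<omega>) = word_prob M X (a @ u) * bsc_kernel \<epsilon> u z" .
  qed
  finally show ?thesis by (simp add: noisy_def)
qed

lemma binary_process_output: "binary_process M (bsc_output X N)"
  unfolding binary_process_def
proof (intro allI impI)
  fix i :: int assume i: "i \<le> 0"
  have "{\<omega> \<in> space M. X i \<omega>} \<in> events" "{\<omega> \<in> space M. N i \<omega>} \<in> events"
    using measurable_sets[OF measurable_source[OF i], of "{True}"]
      measurable_sets[OF measurable_noise[OF i], of "{True}"]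
    by (simp_all add: vimage_def Int_def conj_commute)
  then have "Measurable.pred M (X i)" "Measurable.pred M (N i)" by (simp_all add: pred_def)
  then show "bsc_output X N i \<in> M \<rightarrow>\<^sub>M count_space UNIV"
    unfolding bsc_output_def[abs_def] by measurable
qed

end

section \<open>Transfer from word distributions to the processes\<close>

text \<open>Decodes the index set of the third sum of \<open>g_coeff\<close>. The upper bound forces
  the constant to vanish; with \<open>b = 0\<close> the function would be quadratically small,
  against the lower bound.\<close>

lemma first_order_bigtheta_iff:
  assumes Q: "first_order Q a b"
  shows "Q \<in> \<Theta>[at_right 0](\<lambda>\<epsilon>. \<epsilon>) \<longleftrightarrow> a = 0 \<and> b \<noteq> 0"
proof
  assume "Q \<in> \<Theta>[at_right 0](\<lambda>\<epsilon>. \<epsilon>)"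
  then have O: "Q \<in> O[at_right 0](\<lambda>\<epsilon>. \<epsilon>)" and Om: "(\<lambda>\<epsilon>. \<epsilon>) \<in> O[at_right 0](Q)"
    by (auto simp: bigtheta_def bigomega_iff_bigo)
  have "(\<lambda>\<epsilon>. Q \<epsilon> - (Q \<epsilon> - a)) \<in> O[at_right 0](\<lambda>\<epsilon>. \<epsilon>)"
    by (intro sum_in_bigo O first_order_zero_order[OF Q])
  then have c: "(\<lambda>_. a) \<in> O[at_right 0](\<lambda>\<epsilon>::real. \<epsilon>)" by simp
  have small: "(\<lambda>\<epsilon>::real. \<epsilon>) \<in> o[at_right 0](\<lambda>_. 1::real)" "(\<lambda>\<epsilon>::real. \<epsilon>\<^sup>2) \<in> o[at_right 0](\<lambda>\<epsilon>. \<epsilon>)"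
    by real_asymp+
  have a: "a = 0"
  proof (rule ccontr)
    assume "a \<noteq> 0"
    then have "(\<lambda>_. 1) \<in> O[at_right 0](\<lambda>\<epsilon>::real. \<epsilon>)" using c by simp
    from landau_o.big_small_trans[OF this small(1)] show False by (simp add: landau_o.small_refl_iff)
  qed
  have "b \<noteq> 0"
  proof
    assume "b = 0"
    then have "Q \<in> O[at_right 0](\<lambda>\<epsilon>. \<epsilon>\<^sup>2)" using Q a by (simp add: first_order_def)
    from landau_o.big_small_trans[OF landau_o.big_trans[OF Om this] small(2)]
    have "\<forall>\<^sub>F \<epsilon>::real in at_right 0. \<epsilon> = 0" by (simp add: landau_o.small_refl_iff)
    moreover have "\<forall>\<^sub>F \<epsilon>::real in at_right 0. \<epsilon> \<noteq> 0" by (auto simp: eventually_at intro!: exI[of _ 1])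
    ultimately have "\<forall>\<^sub>F \<epsilon>::real in at_right 0. False" by eventually_elim simp
    then show False by simp
  qed
  with a show "a = 0 \<and> b \<noteq> 0" by simp
next
  assume ab: "a = 0 \<and> b \<noteq> 0"
  have small: "(\<lambda>\<epsilon>::real. \<epsilon>\<^sup>2) \<in> o[at_right 0](\<lambda>\<epsilon>. \<epsilon>)" by real_asymp
  have "(\<lambda>\<epsilon>. Q \<epsilon> - b * \<epsilon>) \<in> O[at_right 0](\<lambda>\<epsilon>. \<epsilon>\<^sup>2)"
    using Q ab by (simp add: first_order_def)
  from landau_o.big_small_trans[OF this small]
  have "(\<lambda>\<epsilon>. Q \<epsilon> - b * \<epsilon>) \<in> o[at_right 0](\<lambda>\<epsilon>. b * \<epsilon>)" using ab by simp
  from landau_theta.plus_absorb2[OF this]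
  have eq: "\<Theta>[at_right 0](Q) = \<Theta>[at_right 0](\<lambda>\<epsilon>. b * \<epsilon>)" by simp
  have "Q \<in> \<Theta>[at_right 0](\<lambda>\<epsilon>. b * \<epsilon>)" unfolding eq[symmetric] by (rule bigtheta_refl)
  then show "Q \<in> \<Theta>[at_right 0](\<lambda>\<epsilon>. \<epsilon>)" using ab by simp
qed

theorem theorem2p4:
  fixes M :: "'a measure"
    and X :: "int \<Rightarrow> 'a \<Rightarrow> bool"
    and E :: "real \<Rightarrow> int \<Rightarrow> 'a \<Rightarrow> bool"
    and m :: nat
  assumes "prob_space M"
    and "binary_process M X"
    and "stationary M X"
    and "markov_of_order M m X"
    and "irreducible_of_order M m X"
    and "\<And>\<epsilon>. 0 < \<epsilon> \<Longrightarrow> \<epsilon> < 1 \<Longrightarrow> bsc_noise M X \<epsilon> (E \<epsilon>)"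
  shows "f_coeff M X (2 * m) 0 = f_coeff M X (2 * m) m \<and>
         g_coeff M X E (3 * m) 0 = g_coeff M X E (3 * m) m \<and>
         (\<lambda>\<epsilon>. entropy_rate M (bsc_output X (E \<epsilon>))
               - (entropy_rate M X
                  + f_coeff M X (2 * m) 0 * (\<epsilon> * ln (1 / \<epsilon>))
                  + g_coeff M X E (3 * m) 0 * \<epsilon>))
           \<in> O[at_right 0](\<lambda>\<epsilon>. \<epsilon>\<^sup>2 * ln \<epsilon>)"
proof -
  interpret prob_space M by fact
  interpret X: stationary_source M X
    by unfold_locales (use assms(2,3) in \<open>auto simp: binary_process_def\<close>)
  interpret p: markov_words "word_prob M X" m
    by (rule X.markov_words_word_prob) fact
  have noisy: "noisy_source M X \<epsilon> (E \<epsilon>)" if "0 < \<epsilon>" "\<epsilon> < 1" for \<epsilon>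
    by unfold_locales (use assms(6) that in auto)
  have h: "h_coeff M X k u = p.hc k u" for k u
    by (simp add: h_coeff_def p.hc_def)
  have dead: "\<not> word_prob M X u > 0 \<longleftrightarrow> word_prob M X u = 0" for u
    using p.nonneg[of u] by auto
  have f: "f_coeff M X n k = p.f_sum n k" for n k
    by (simp add: f_coeff_def sum_word_letter_pairs p.f_sum_def p.f_term_def h allowed_words_def)
  have theta: "pXZ M X E n k u \<in> \<Theta>[at_right 0](\<lambda>\<epsilon>. \<epsilon>) \<longleftrightarrow> word_prob M X u = 0 \<and> p.hc k u \<noteq> 0"
    \<comment> \<open>The block starts at time \<open>-n\<close>, so the second bound keeps it at
      times up to 0.\<close>
    if "k \<le> length u" "length u \<le> n + 1" for n k u
  proof -
    have "pXZ M X E n k u \<epsilon> = p.obs k \<epsilon> u" if e: "0 < \<epsilon>" "\<epsilon> < 1" for \<epsilon>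
    proof -
      interpret Z: noisy_source M X \<epsilon> "E \<epsilon>" by (rule noisy[OF e])
      show ?thesis
        using Z.prob_block_output[of "- int n" "take k u" "drop k u"] \<open>k \<le> length u\<close> \<open>length u \<le> n + 1\<close>
        by (simp add: pXZ_def p.obs_def min_absorb2)
    qed
    then have "\<forall>\<^sub>F \<epsilon> in at_right 0. pXZ M X E n k u \<epsilon> = p.obs k \<epsilon> u"
      by (auto simp: eventually_at intro!: exI[of _ 1])
    then have "pXZ M X E n k u \<in> \<Theta>[at_right 0](\<lambda>\<epsilon>. \<epsilon>) \<longleftrightarrow> (\<lambda>\<epsilon>. p.obs k \<epsilon> u) \<in> \<Theta>[at_right 0](\<lambda>\<epsilon>. \<epsilon>)"
      by (rule landau_theta.in_cong)
    then show ?thesis by (simp add: first_order_bigtheta_iff[OF p.obs_first_order[OF that(1)]])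
  qed
  have g: "g_coeff M X E n k = p.g_sum n k" if k: "k \<le> n" for n k
  proof -
    \<comment> \<open>The guard of \<open>g_term\<close> does not mention
      \<open>word_prob M X (w @ [v]) = 0\<close>: this follows once \<open>w\<close> has probability
      zero.\<close>
    have third: "(pXZ M X E n k w \<in> \<Theta>[at_right 0](\<lambda>\<epsilon>. \<epsilon>) \<and> pXZ M X E n k (w @ [v]) \<in> \<Theta>[at_right 0](\<lambda>\<epsilon>. \<epsilon>))
       \<longleftrightarrow> word_prob M X w = 0 \<and> p.hc k w \<noteq> 0 \<and> p.hc k (w @ [v]) \<noteq> 0" if "length w = n" for w v
      using theta[of k w n] theta[of k "w @ [v]" n] that k p.snoc_le[of w v] p.nonneg[of "w @ [v]"] by auto
    have "p.g_sum n k = - (\<Sum>w\<in>words n. \<Sum>v\<in>UNIV. p.g_term k w v)" by (simp add: p.g_sum_def)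
    also have "\<dots> = g_coeff M X E n k"
      unfolding g_coeff_def sum_word_letter_pairs p.g_term_def sum.distrib minus_add_distrib
        diff_conv_add_uminus
      by (intro arg_cong2[of _ _ _ _ "(+)"] arg_cong[of _ _ uminus] sum.cong refl if_cong)
         (auto simp: allowed_words_def next_prob_def h third)
    finally show ?thesis by simp
  qed
  have "\<P>(\<omega> in M. block X (- int n) (n + 1) \<omega> = u) = word_prob M X u" if "length u = n + 1" for n u
    using X.prob_block_eq_word_prob[of "- int n" u] that by simp
  then have rate: "entropy_rate M X = p.rate"
    unfolding entropy_rate_def p.rate_def block_entropy_eq[OF assms(1,2)]
    by (intro arg_cong[of _ _ lim] ext) (auto intro!: sum.cong)
  have rate_Z: "entropy_rate M (bsc_output X (E \<epsilon>)) = stationary_words.rate (p.obs 0 \<epsilon>)"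
    if e: "0 < \<epsilon>" "\<epsilon> < 1" for \<epsilon>
  proof -
    interpret Z: noisy_source M X \<epsilon> "E \<epsilon>" by (rule noisy[OF e])
    interpret z: stationary_words "p.obs 0 \<epsilon>" by (rule p.stationary_words_obs) (use e in auto)
    have "\<P>(\<omega> in M. block (bsc_output X (E \<epsilon>)) (- int n) (n + 1) \<omega> = u) = p.obs 0 \<epsilon> u"
      if "length u = n + 1" for n u
      using Z.prob_block_output[of "- int n" "[]" u] that by (simp add: p.obs_0)
    then show ?thesis
      unfolding entropy_rate_def z.rate_def block_entropy_eq[OF assms(1) Z.binary_process_output]
      by (intro arg_cong[of _ _ lim] ext) (auto intro!: sum.cong)
  qed
  have "\<forall>\<^sub>F \<epsilon> in at_right 0. entropy_rate M (bsc_output X (E \<epsilon>))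
      - (entropy_rate M X + f_coeff M X (2 * m) 0 * (\<epsilon> * ln (1 / \<epsilon>)) + g_coeff M X E (3 * m) 0 * \<epsilon>)
    = stationary_words.rate (p.obs 0 \<epsilon>)
      - (p.rate + p.f_sum (2 * m) 0 * (\<epsilon> * ln (1 / \<epsilon>)) + p.g_sum (3 * m) 0 * \<epsilon>)"
    using rate_Z by (auto simp: eventually_at rate f g intro!: exI[of _ 1])
  from bigo_eventually_eq[OF this p.rate_obs_expansion]
  show ?thesis using p.f_sum_eq[of "2 * m"] p.g_sum_eq[of "3 * m"] by (simp add: f g)
qed

end
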